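(* The Mathieu group $M_{22}$ is generated by symbols $\mathfrak{s},\mathfrak{j},\mathfrak{t},\mathfrak{r},\mathfrak{u}$, subject to the defining relations $$\mathfrak{s}^2=\mathfrak{j}^2=\mathfrak{t}^2=\mathfrak{r}^3=(\mathfrak{j}\mathfrak{r})^2=(\mathfrak{t}\mathfrak{r})^2=(\mathfrak{s}\mathfrak{r})^3=(\mathfrak{j}\mathfrak{s})^3=(\mathfrak{t}\mathfrak{j})^3=(\mathfrak{t}\mathfrak{s}\mathfrak{t}\mathfrak{j}\mathfrak{s})^3=1,$$ $$\mathfrak{t}\mathfrak{s}\mathfrak{t}\cdot\mathfrak{j}\mathfrak{r}\cdot\mathfrak{t}\mathfrak{s}\mathfrak{t}=\mathfrak{r}\mathfrak{s}\mathfrak{r}^{-1}\mathfrak{j}\mathfrak{r}\cdot\mathfrak{t}\mathfrak{s}\mathfrak{t}\cdot\mathfrak{r}\mathfrak{s}\mathfrak{r}^{-1}\mathfrak{j}\mathfrak{r}^{-1}\mathfrak{s}\mathfrak{r}^{-1},$$ $$\mathfrak{u}^2=(\mathfrak{u}\mathfrak{s})^2=(\mathfrak{u}\mathfrak{j})^3=1,\quad \mathfrak{r}^{\mathfrak{u}}=\mathfrak{r}^{\mathfrak{j}},\quad \mathfrak{s}^{\mathfrak{t}\mathfrak{u}}=\mathfrak{s}\,\mathfrak{s}^{\mathfrak{t}},\quad \mathfrak{s}^{\mathfrak{j}\mathfrak{t}\mathfrak{u}}=\mathfrak{s}^{\mathfrak{j}\mathfrak{t}}\,\mathfrak{s}^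{\mathfrak{t}\mathfrak{j}\mathfrak{t}}.$$
   Context: Conventions: $x^y=y^{-1}xy$; permutations are composed from right to left. The statement means that the abstract group with this presentation is isomorphic to $M_{22}$, with the symbols corresponding to the following permutations. Let $\zeta$ be a primitive element of $GF(4)$ and $\Omega=\mathbb{P}^2(4)$ the set of 21 points $[x,y,z]$ of the projective plane over $GF(4)$, on which matrices act by left multiplication on column vectors $(x,y,z)^t$. Let $u\notin\Omega$ be a new point and $\Omega'=\Omega\cup\{u\}$. The symbols $\mathfrak{s},\mathfrak{j},\mathfrak{t},\mathfrak{r}$ correspond to the elements of $PSL_3(4)$ (acting on $\Omega$, fixing $u$) induced by the matrices $\begin{pmatrix}1&1&0\\0&1&0\\0&0&1\end{pmatrix}$, $\begin{pmatrix}0&1&0\\1&0&0\\0&0&1\end{pmatrix}$, $\begin{pmatrix}0&0&1\\0&1&0\\1&0&0\end{pmatrix}$, $\begin{pmatrix}\zeta&0&0\\0&1&0\\0&0&\zeta^{-1}\end{pmatrix}$, respectively, and $\mathfrak{u}$ to the permutation with $u\mapsto[1,0,0]$, $[1,0,0]\mapsto u$, and $[x,y,z]\mapsto[x^2+yz,y^2,z^2]$ for $[x,y,z]\in\Omega\setminus\{[1,0,0]\}$. $M_{22}$ is the ($3$-transitive) permutation group on $\Omega'$ generated by $PSL_3(4)$ and $\mathfrak{u}$. *)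

theory Defs
  imports "HOL-Analysis.Determinants" "HOL-Algebra.Bij" "HOL-Algebra.Elementary_Groups"
begin

section \<open>Groups given by generators and relations\<close>

text \<open>
  A word over the symbols \<open>'a\<close> is a list of letters; \<open>(x, True)\<close> stands for the symbol \<open>x\<close> and
  \<open>(x, False)\<close> for its formal inverse. The empty word stands for \<open>1\<close>, and juxtaposition is \<open>@\<close>.
\<close>

type_synonym 'a word = "('a \<times> bool) list"

definition word_inv :: "'a word \<Rightarrow> 'a word" where
  "word_inv w = rev (map (\<lambda>(x, b). (x, \<not> b)) w)"

definition word_pow :: "'a word \<Rightarrow> nat \<Rightarrow> 'a word" where
  "word_pow w n = concat (replicate n w)"

definition word_conj :: "'a word \<Rightarrow> 'a word \<Rightarrow> 'a word" where
  "word_conj v w = word_inv w @ v @ w"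

text \<open>
  The least congruence on words which contains the pairs in \<open>R\<close> and makes a letter cancel against
  its formal inverse. Its classes form the free group modulo the normal closure of \<open>R\<close>.
\<close>

inductive word_equiv :: "('a word \<times> 'a word) set \<Rightarrow> 'a word \<Rightarrow> 'a word \<Rightarrow> bool"
  for R :: "('a word \<times> 'a word) set" where
  relation: "(v, w) \<in> R \<Longrightarrow> word_equiv R v w"
| cancel: "word_equiv R [(x, b), (x, \<not> b)] []"
| refl: "word_equiv R w w"
| sym: "word_equiv R v w \<Longrightarrow> word_equiv R w v"
| trans: "word_equiv R v w \<Longrightarrow> word_equiv R w z \<Longrightarrow> word_equiv R v z"
| append: "word_equiv R v v' \<Longrightarrow> word_equiv R w w' \<Longrightarrow> word_equiv R (v @ w) (v' @ w')"

definition word_class :: "('a word \<times> 'a word) set \<Rightarrow> 'a word \<Rightarrow> 'a word set" where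
  "word_class R w = {w'. word_equiv R w w'}"

definition presented_group :: "('a word \<times> 'a word) set \<Rightarrow> 'a word set monoid" where
  "presented_group R =
    \<lparr>carrier = range (word_class R),
     mult = (\<lambda>A B. \<Union>v\<in>A. \<Union>w\<in>B. word_class R (v @ w)),
     one = word_class R []\<rparr>"

lemma carrier_presented_group: "carrier (presented_group R) = range (word_class R)"
  by (simp add: presented_group_def)

lemma one_presented_group: "\<one>\<^bsub>presented_group R\<^esub> = word_class R []"
  by (simp add: presented_group_def)

lemma word_class_eq_iff: "word_class R v = word_class R w \<longleftrightarrow> word_equiv R v w"
proof
  assume "word_class R v = word_class R w"
  moreover have "w \<in> word_class R w"
    by (simp add: word_class_def word_equiv.refl)
  ultimately show "word_equiv R v w"
    by (simp add: word_class_def set_eq_iff)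
next
  assume *: "word_equiv R v w"
  show "word_class R v = word_class R w"
    unfolding word_class_def
    using word_equiv.trans[OF *] word_equiv.trans[OF word_equiv.sym[OF *]] by blast
qed

lemma mult_presented_group:
  "word_class R v \<otimes>\<^bsub>presented_group R\<^esub> word_class R w = word_class R (v @ w)"
proof -
  have "word_class R (v' @ w') = word_class R (v @ w)"
    if "v' \<in> word_class R v" "w' \<in> word_class R w" for v' w'
    unfolding word_class_eq_iff
    using that by (intro word_equiv.append; simp add: word_class_def word_equiv.sym)
  moreover have "v \<in> word_class R v" "w \<in> word_class R w"
    by (simp_all add: word_class_def word_equiv.refl)
  ultimately have "(\<Union>v'\<in>word_class R v. \<Union>w'\<in>word_class R w. word_class R (v' @ w')) =
      word_class R (v @ w)"
    by blast
  then show ?thesis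
    by (simp add: presented_group_def)
qed

lemma word_equiv_inv_left: "word_equiv R (word_inv w @ w) []"
proof (induction w)
  case Nil
  show ?case by (simp add: word_inv_def word_equiv.refl)
next
  case (Cons a w)
  obtain x b where a: "a = (x, b)" by (cases a)
  have "word_equiv R [(x, \<not> b), (x, b)] []"
    using word_equiv.cancel[of R x "\<not> b"] by simp
  then have "word_equiv R ((word_inv w @ [(x, \<not> b), (x, b)]) @ w) ((word_inv w @ []) @ w)"
    by (rule word_equiv.append[OF word_equiv.append[OF word_equiv.refl] word_equiv.refl])
  with Cons have "word_equiv R ((word_inv w @ [(x, \<not> b), (x, b)]) @ w) []"
    by (simp only: append_Nil2) (rule word_equiv.trans)
  then show ?case by (simp add: a word_inv_def)
qed

lemma group_presented_group: "group (presented_group R)" (is "group ?G")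
proof (rule groupI; unfold carrier_presented_group)
  show "\<one>\<^bsub>?G\<^esub> \<in> range (word_class R)"
    by (simp add: one_presented_group)
next
  fix A B assume "A \<in> range (word_class R)" "B \<in> range (word_class R)"
  then show "A \<otimes>\<^bsub>?G\<^esub> B \<in> range (word_class R)"
    by (clarsimp simp: mult_presented_group)
next
  fix A B C
  assume "A \<in> range (word_class R)" "B \<in> range (word_class R)" "C \<in> range (word_class R)"
  then show "A \<otimes>\<^bsub>?G\<^esub> B \<otimes>\<^bsub>?G\<^esub> C = A \<otimes>\<^bsub>?G\<^esub> (B \<otimes>\<^bsub>?G\<^esub> C)"
    by (clarsimp simp: mult_presented_group)
next
  fix A assume "A \<in> range (word_class R)"
  then obtain v where A: "A = word_class R v" by blast
  show "\<one>\<^bsub>?G\<^esub> \<otimes>\<^bsub>?G\<^esub> A = A"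
    by (simp add: A one_presented_group mult_presented_group)
  have "word_class R (word_inv v) \<otimes>\<^bsub>?G\<^esub> A = \<one>\<^bsub>?G\<^esub>"
    by (simp add: A one_presented_group mult_presented_group word_class_eq_iff word_equiv_inv_left)
  then show "\<exists>B\<in>range (word_class R). B \<otimes>\<^bsub>?G\<^esub> A = \<one>\<^bsub>?G\<^esub>"
    by blast
qed


section \<open>The presentation\<close>

datatype gen = Gs | Gj | Gt | Gr | Gu

definition gen_word :: "gen \<Rightarrow> gen word" where
  "gen_word x = [(x, True)]"

definition m22_relations :: "(gen word \<times> gen word) set" where
  "m22_relations =
    (let s = gen_word Gs; j = gen_word Gj; t = gen_word Gt; r = gen_word Gr; u = gen_word Gu;
         r' = word_inv r
     in {(word_pow s 2, []),
         (word_pow j 2, []),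
         (word_pow t 2, []),
         (word_pow r 3, []),
         (word_pow (j @ r) 2, []),
         (word_pow (t @ r) 2, []),
         (word_pow (s @ r) 3, []),
         (word_pow (j @ s) 3, []),
         (word_pow (t @ j) 3, []),
         (word_pow (t @ s @ t @ j @ s) 3, []),
         ((t @ s @ t) @ (j @ r) @ (t @ s @ t),
          (r @ s @ r' @ j @ r) @ (t @ s @ t) @ (r @ s @ r' @ j @ r' @ s @ r')),
         (word_pow u 2, []),
         (word_pow (u @ s) 2, []),
         (word_pow (u @ j) 3, []),
         (word_conj r u, word_conj r j),
         (word_conj s (t @ u), s @ word_conj s t),
         (word_conj s (j @ t @ u), word_conj s (j @ t) @ word_conj s (t @ j @ t))})"


section \<open>The permutation group\<close>

definition primitive_element :: "'k::field \<Rightarrow> bool" where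
  "primitive_element z \<longleftrightarrow> range (\<lambda>n::nat. z ^ n) = - {0}"

text \<open>The point \<open>[x, y, z]\<close> of the projective plane is the line spanned by \<open>(x, y, z)\<close>.\<close>

type_synonym 'k point = "('k ^ 3) set"

definition proj_point :: "'k::field ^ 3 \<Rightarrow> 'k point" where
  "proj_point v = vec.span {v}"

definition proj_plane :: "'k::field point set" where
  "proj_plane = proj_point ` (- {0})"

text \<open>\<open>None\<close> is the additional point \<open>u\<close>.\<close>

definition ext_plane :: "'k::field point option set" where
  "ext_plane = insert None (Some ` proj_plane)"

definition mat_perm :: "'k::field ^ 3 ^ 3 \<Rightarrow> 'k point option \<Rightarrow> 'k point option" where
  "mat_perm A = (\<lambda>p\<in>ext_plane. map_option (\<lambda>P. (\<lambda>v. A *v v) ` P) p)"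

definition u_map :: "'k::field ^ 3 \<Rightarrow> 'k ^ 3" where
  "u_map v = vector [(v $ 1)\<^sup>2 + v $ 2 * v $ 3, (v $ 2)\<^sup>2, (v $ 3)\<^sup>2]"

lemma field_card4_bij_square:
  assumes "CARD('k::field) = 4"
  shows "bij (\<lambda>c::'k. c\<^sup>2)"
proof -
  have fin: "finite (UNIV :: 'k set)"
    using assms card.infinite by fastforce
  have two: "(1::'k) = - 1"
  proof (rule ccontr)
    assume ne: "(1::'k) \<noteq> - 1"
    define A where "A = {0, 1, - 1 :: 'k}"
    have "card A = 3"
      using ne by (auto simp: A_def)
    then have "card (- A) = 1"
      using assms fin by (simp add: card_Diff_subset Compl_eq_Diff_UNIV A_def)
    then obtain w where w: "- A = {w}"
      by (auto simp: card_1_singleton_iff)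
    then have "w \<notin> A" by blast
    then have "- w \<in> - A"
      by (auto simp: A_def minus_equation_iff[of w] equation_minus_iff[of w])
    then have "- w = w" using w by simp
    then have "(1 + 1) * w = 0"
      by (metis add.right_inverse distrib_right mult_1)
    moreover have "w \<noteq> 0" using \<open>w \<notin> A\<close> by (auto simp: A_def)
    ultimately have "(1::'k) + 1 = 0" by simp
    then show False using ne by (simp add: eq_neg_iff_add_eq_0)
  qed
  have "inj (\<lambda>c::'k. c\<^sup>2)"
  proof (rule injI)
    fix a b :: 'k assume "a\<^sup>2 = b\<^sup>2"
    then have "a = b \<or> a = - b" by (simp add: power2_eq_iff)
    moreover have "- b = b" using two by (metis mult_1 mult_minus_left)
    ultimately show "a = b" by simp
  qed
  with fin show ?thesis
    by (simp add: bij_def finite_UNIV_inj_surj)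
qed

text \<open>
  The image of the line \<open>[x, y, z]\<close> under \<^const>\<open>u_map\<close> is indeed the line \<open>[x\<^sup>2 + yz, y\<^sup>2, z\<^sup>2]\<close>.
\<close>

lemma u_map_proj_point:
  fixes v :: "'k::field ^ 3"
  assumes "CARD('k) = 4"
  shows "u_map ` proj_point v = proj_point (u_map v)"
proof -
  have scale: "u_map (c *s v) = c\<^sup>2 *s u_map v" for c
    by (simp add: u_map_def vec_eq_iff forall_3 algebra_simps power2_eq_square)
  have "u_map ` proj_point v = (\<lambda>c. c *s u_map v) ` range (\<lambda>c. c\<^sup>2)"
    by (simp add: proj_point_def vec.span_singleton image_image scale)
  also have "range (\<lambda>c::'k. c\<^sup>2) = UNIV"
    using field_card4_bij_square[OF assms] by (simp add: bij_is_surj)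
  finally show ?thesis
    by (simp add: proj_point_def vec.span_singleton)
qed

definition u_perm :: "'k::field point option \<Rightarrow> 'k point option" where
  "u_perm = (\<lambda>p\<in>ext_plane. case p of
      None \<Rightarrow> Some (proj_point (vector [1, 0, 0]))
    | Some P \<Rightarrow> if P = proj_point (vector [1, 0, 0]) then None else Some (u_map ` P))"

definition psl3 :: "('k::field point option \<Rightarrow> 'k point option) set" where
  "psl3 = mat_perm ` {A. det A = 1}"

text \<open>Multiplication in \<^const>\<open>BijGroup\<close> is composition from right to left.\<close>

definition m22 :: "('k::field point option \<Rightarrow> 'k point option) monoid" where
  "m22 = subgroup_generated (BijGroup ext_plane) (insert u_perm psl3)"

fun gen_perm :: "'k::field \<Rightarrow> gen \<Rightarrow> 'k point option \<Rightarrow> 'k point option" where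
  "gen_perm z Gs = mat_perm (vector [vector [1, 1, 0], vector [0, 1, 0], vector [0, 0, 1]])"
| "gen_perm z Gj = mat_perm (vector [vector [0, 1, 0], vector [1, 0, 0], vector [0, 0, 1]])"
| "gen_perm z Gt = mat_perm (vector [vector [0, 0, 1], vector [0, 1, 0], vector [1, 0, 0]])"
| "gen_perm z Gr = mat_perm (vector [vector [z, 0, 0], vector [0, 1, 0], vector [0, 0, inverse z]])"
| "gen_perm z Gu = u_perm"

end

theory Submission
  imports Defs
begin

text \<open>
  The permutations satisfy the relations, and \<open>SL\<^sub>3(4)\<close> is generated by transvections, all of which are
  conjugate to \<open>s\<close> or to \<open>s\<^sup>r\<close>, \<open>s\<^bsup>r\<inverse>\<^esup>\<close> under \<open>j\<close> and \<open>t\<close>; so the presented group maps onto \<open>M\<^sub>2\<^sub>2\<close>. For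
  injectivity, coset enumeration is carried out along the chain \<open>G > \<langle>s, j, t, r\<rangle> > \<langle>s, j, r\<rangle> > 1\<close>, with
  indices at most 22, 336 and 60. These subgroups stabilise the point \<open>u\<close>, an antiflag of the plane, and
  each single point, respectively, whereas every nontrivial coset representative moves the corresponding
  object. A word acting trivially therefore descends the chain to the trivial word. Each enumeration is a
  certificate of coset definitions and deductions, checked by evaluation in the logic.
\<close>

section \<open>Words over the generators and their inverses\<close>

text \<open>All generators but \<open>r\<close> are involutions, so only \<open>r\<close> needs a letter for its inverse.\<close>

datatype letter = S | J | T | R | R' | U

fun linv :: "letter \<Rightarrow> letter" where
  "linv R = R'"
| "linv R' = R"
| "linv x = x"

definition winv :: "letter list \<Rightarrow> letter list" where
  "winv w = rev (map linv w)"

fun letter_of :: "gen \<times> bool \<Rightarrow> letter" where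
  "letter_of (Gs, _) = S"
| "letter_of (Gj, _) = J"
| "letter_of (Gt, _) = T"
| "letter_of (Gr, b) = (if b then R else R')"
| "letter_of (Gu, _) = U"

fun of_letter :: "letter \<Rightarrow> gen \<times> bool" where
  "of_letter S = (Gs, True)"
| "of_letter J = (Gj, True)"
| "of_letter T = (Gt, True)"
| "of_letter R = (Gr, True)"
| "of_letter R' = (Gr, False)"
| "of_letter U = (Gu, True)"

abbreviation letters_of :: "gen word \<Rightarrow> letter list" where
  "letters_of w \<equiv> map letter_of w"

abbreviation of_letters :: "letter list \<Rightarrow> gen word" where
  "of_letters w \<equiv> map of_letter w"

section \<open>Equality in the presented group, in terms of letters\<close>

definition equ :: "letter list \<Rightarrow> letter list \<Rightarrow> bool" (infix "\<approx>" 50) where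
  "v \<approx> w \<longleftrightarrow> word_equiv m22_relations (of_letters v) (of_letters w)"

lemma equ_refl [simp]: "w \<approx> w"
  by (simp add: equ_def word_equiv.refl)

lemma equ_sym: "v \<approx> w \<Longrightarrow> w \<approx> v"
  by (simp add: equ_def word_equiv.sym)

lemma equ_trans [trans]: "v \<approx> w \<Longrightarrow> w \<approx> z \<Longrightarrow> v \<approx> z"
  unfolding equ_def by (rule word_equiv.trans)

lemma equ_append: "v \<approx> v' \<Longrightarrow> w \<approx> w' \<Longrightarrow> v @ w \<approx> v' @ w'"
  unfolding equ_def by (simp add: word_equiv.append)

text \<open>Only inverses of involutions change their spelling: if \<open>x x\<close> is trivial,
  then \<open>x\<inverse> = x\<inverse> x x = x\<close>.\<close>

lemma word_equiv_letters: "word_equiv m22_relations w (of_letters (letters_of w))"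
proof (induction w)
  case Nil
  show ?case by (simp add: word_equiv.refl)
next
  case (Cons a w)
  have inv: "word_equiv m22_relations [(x, False)] [(x, True)]"
    if "word_equiv m22_relations [(x, True), (x, True)] []" for x
  proof -
    have "word_equiv m22_relations ([(x, False)] @ []) ([(x, False)] @ [(x, True), (x, True)])"
      by (rule word_equiv.append[OF word_equiv.refl word_equiv.sym[OF that]])
    moreover have "word_equiv m22_relations ([(x, False), (x, True)] @ [(x, True)]) ([] @ [(x, True)])"
      using word_equiv.cancel[of m22_relations x False]
      by (intro word_equiv.append[OF _ word_equiv.refl]) simp
    ultimately show ?thesis
      using word_equiv.trans by fastforce
  qed
  have "word_equiv m22_relations [(x, True), (x, True)] []" if "x \<noteq> Gr" for x
    using that
    by (cases x; intro word_equiv.relation)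
      (auto simp: m22_relations_def Let_def word_pow_def gen_word_def numeral_2_eq_2)
  then have "word_equiv m22_relations [(x, b)] [of_letter (letter_of (x, b))]" for x b
    by (cases x; cases b) (simp_all add: word_equiv.refl inv)
  then have "word_equiv m22_relations [a] [of_letter (letter_of a)]"
    by (metis surj_pair)
  from word_equiv.append[OF this Cons] show ?case by simp
qed

lemma letters_of_inverse [simp]: "letters_of (of_letters w) = w"
proof (induction w)
  case (Cons x w)
  then show ?case by (cases x) auto
qed simp

text \<open>Transfers results on letter lists back to words over the generators: passing to letters
  and back does not change the class of a word.\<close>

lemma equ_letters_of_iff: "letters_of v \<approx> letters_of w \<longleftrightarrow> word_equiv m22_relations v w"
  unfolding equ_def
  by (meson word_equiv.sym word_equiv.trans word_equiv_letters)

lemma linv_linv [simp]: "linv (linv x) = x"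
  by (cases x) auto

lemma winv_simps [simp]:
  "winv [] = []" "winv (x # w) = winv w @ [linv x]" "winv (v @ w) = winv w @ winv v"
  "winv (winv w) = w"
  by (simp_all add: winv_def rev_map o_def)

lemma equ_linv: "[x, linv x] \<approx> []"
proof -
  obtain a b where ab: "of_letter x = (a, b)" by (cases "of_letter x")
  then have "letters_of [(a, b), (a, \<not> b)] = [x, linv x]" by (cases x) auto
  moreover have "letters_of [(a, b), (a, \<not> b)] \<approx> letters_of []"
    unfolding equ_letters_of_iff by (rule word_equiv.cancel)
  ultimately show ?thesis by simp
qed

lemma equ_winv: "w @ winv w \<approx> []"
proof (induction w)
  case (Cons x w)
  have "[x] @ (w @ winv w) @ [linv x] \<approx> [x] @ [] @ [linv x]"
    by (intro equ_append equ_refl Cons)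
  also have "\<dots> \<approx> []" using equ_linv[of x] by simp
  finally show ?case by simp
qed simp

lemma equ_winv': "winv w @ w \<approx> []"
  using equ_winv[of "winv w"] by simp

lemma equ_solve_left:
  assumes "u @ v \<approx> w"
  shows "v \<approx> winv u @ w"
proof -
  have "[] @ v \<approx> (winv u @ u) @ v"
    by (intro equ_append equ_refl equ_sym[OF equ_winv'])
  also have "(winv u @ u) @ v \<approx> winv u @ w"
    unfolding append_assoc by (intro equ_append equ_refl assms)
  finally show ?thesis by simp
qed

lemma equ_solve_right:
  assumes "u @ v \<approx> w"
  shows "u \<approx> w @ winv v"
proof -
  have "u @ [] \<approx> u @ (v @ winv v)"
    by (intro equ_append equ_refl equ_sym[OF equ_winv])
  also have "u @ (v @ winv v) \<approx> w @ winv v"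
    unfolding append_assoc[symmetric] by (intro equ_append equ_refl assms)
  finally show ?thesis by simp
qed

text \<open>Each relation \<open>a = b\<close> is listed as \<open>a b\<inverse>\<close>, without
  free reduction, in the order of \<open>m22_relations\<close>. The certificates refer to these
  positions, counted from 0.\<close>

definition relators :: "letter list list" where
  "relators =
    [[S, S], [J, J], [T, T], [R, R, R], [J, R, J, R], [T, R, T, R], [S, R, S, R, S, R], [J, S, J,
    S, J, S], [T, J, T, J, T, J], [T, S, T, J, S, T, S, T, J, S, T, S, T, J, S], [T, S, T, J, R,
    T, S, T, R, S, R, J, R, S, R', T, S, T, R', J, R, S, R'], [U, U], [U, S, U, S], [U, J, U, J,
    U, J], [U, R, U, J, R', J], [U, T, S, T, U, T, S, T, S], [U, T, J, S, J, T, U, T, J, T, S, T,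
    J, T, T, J, S, J, T]]"

lemma relators_from_relations:
  "\<forall>w\<in>set relators. \<exists>(a, b)\<in>m22_relations. w = letters_of a @ winv (letters_of b)"
  by code_simp

lemma relator_equ:
  assumes "w \<in> set relators"
  shows "w \<approx> []"
proof -
  obtain a b where ab: "(a, b) \<in> m22_relations" "w = letters_of a @ winv (letters_of b)"
    using relators_from_relations assms by blast
  then have "letters_of a @ winv (letters_of b) \<approx> letters_of b @ winv (letters_of b)"
    by (intro equ_append equ_refl) (simp add: equ_letters_of_iff word_equiv.relation)
  with ab(2) show ?thesis using equ_winv equ_trans by blast
qed


section \<open>Coset enumeration\<close>

text \<open>Arrays indexed by positive integers, with default entry \<open>[]\<close>.\<close>

datatype 'a trie = Leaf | Node "'a trie" "'a list" "'a trie"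

fun get_num :: "'a trie \<Rightarrow> num \<Rightarrow> 'a list" where
  "get_num Leaf _ = []"
| "get_num (Node l e r) num.One = e"
| "get_num (Node l e r) (num.Bit0 k) = get_num l k"
| "get_num (Node l e r) (num.Bit1 k) = get_num r k"

fun put_num :: "num \<Rightarrow> 'a list \<Rightarrow> 'a trie \<Rightarrow> 'a trie" where
  "put_num num.One e Leaf = Node Leaf e Leaf"
| "put_num (num.Bit0 k) e Leaf = Node (put_num k e Leaf) [] Leaf"
| "put_num (num.Bit1 k) e Leaf = Node Leaf [] (put_num k e Leaf)"
| "put_num num.One e (Node l e' r) = Node l e r"
| "put_num (num.Bit0 k) e (Node l e' r) = Node (put_num k e l) e' r"
| "put_num (num.Bit1 k) e (Node l e' r) = Node l e' (put_num k e r)"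

lemma get_num_put_num: "get_num (put_num k e t) k' = (if k = k' then e else get_num t k')"
proof (induction k e t arbitrary: k' rule: put_num.induct)
qed (case_tac k'; simp)+

definition get :: "'a trie \<Rightarrow> int \<Rightarrow> 'a list" where
  "get t i = (if i > 0 then get_num t (num_of_nat (nat i)) else [])"

definition put :: "int \<Rightarrow> 'a list \<Rightarrow> 'a trie \<Rightarrow> 'a trie" where
  "put i e t = (if i > 0 then put_num (num_of_nat (nat i)) e t else t)"

text \<open>Integer literals are built from \<open>Int.Pos\<close> and \<open>Int.Neg\<close>, so
  evaluation descends the trie along the binary digits of the index.\<close>

lemma get_code [code]:
  "get t (Int.Pos k) = get_num t k" "get t (Int.Neg k) = []" "get t 0 = []"
  by (simp_all add: get_def flip: nat_of_num_numeral add: nat_of_num_inverse)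

lemma put_code [code]:
  "put (Int.Pos k) e t = put_num k e t" "put (Int.Neg k) e t = t" "put 0 e t = t"
  by (simp_all add: put_def flip: nat_of_num_numeral add: nat_of_num_inverse)

lemma get_put: "get (put i e t) j = (if i = j \<and> i > 0 then e else get t j)"
proof -
  have "num_of_nat (nat i) = num_of_nat (nat j) \<longleftrightarrow> i = j" if "i > 0" "j > 0"
    using that by (metis nat_0_less_mult_iff num_of_nat_inverse zero_less_nat_eq nat_eq_iff2 order_less_imp_le)
  then show ?thesis by (simp add: get_def put_def get_num_put_num)
qed

text \<open>
  An entry \<open>(x, j)\<close> in row \<open>i\<close> of a coset table claims that \<open>K w\<^sub>i x = K w\<^sub>j\<close>, where \<open>w\<^sub>i\<close> is the
  representative of the \<open>i\<close>-th coset of the subgroup \<open>K\<close> generated by \<open>X\<close>.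
\<close>

type_synonym coset_table = "(letter \<times> int) trie"

definition add_entry :: "int \<Rightarrow> letter \<times> int \<Rightarrow> coset_table \<Rightarrow> coset_table" where
  "add_entry i e t = put i (e # get t i) t"

text \<open>
  The functions on tables avoid \<open>if\<close>, \<open>case\<close>, \<open>let\<close> and higher-order arguments, which would make the
  simplifier traverse the whole table again at every step.
\<close>

fun link :: "int option \<Rightarrow> letter \<Rightarrow> int option \<Rightarrow> coset_table \<Rightarrow> coset_table" where
  "link (Some i) x (Some j) t = add_entry j (linv x, i) (add_entry i (x, j) t)"
| "link (Some i) x None t = t"
| "link None x j t = t"

fun trace :: "coset_table \<Rightarrow> int option \<Rightarrow> letter list \<Rightarrow> int option" where
  "trace t None w = None"
| "trace t (Some i) [] = Some i"
| "trace t (Some i) (x # w) = trace t (map_of (get t i) x) w"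

fun deduce :: "int \<Rightarrow> letter list \<Rightarrow> letter list \<Rightarrow> coset_table \<Rightarrow> coset_table" where
  "deduce i u [] t = t"
| "deduce i u (x # v) t = link (trace t (Some i) u) x (trace t (Some i) (winv v)) t"

text \<open>The empty default is a trivial word too, so an index out of range cannot make a
  deduction unsound.\<close>

definition relator :: "nat \<Rightarrow> letter list" where
  "relator k = (if k < length relators then relators ! k else [])"

text \<open>
  The step \<open>(i, k, p)\<close> follows the \<open>k\<close>-th relator around from coset \<open>i\<close>, forwards up to its \<open>p\<close>-th
  letter and backwards down to it, and reads off the action of this letter.
\<close>

fun deduce_all :: "(int \<times> nat \<times> nat) list \<Rightarrow> coset_table \<Rightarrow> coset_table" where
  "deduce_all [] t = t"
| "deduce_all ((i, k, p) # ds) t =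
    deduce_all ds (deduce i (take p (relator k)) (drop p (relator k)) t)"

fun add_reps :: "int \<Rightarrow> (int \<times> letter) list \<Rightarrow> letter trie \<Rightarrow> letter trie" where
  "add_reps k [] ws = ws"
| "add_reps k ((p, x) # ps) ws = add_reps (k + 1) ps (put k (get ws p @ [x]) ws)"

text \<open>Comparing the representatives again justifies each entry for arbitrary \<open>ws\<close>
  and \<open>ps\<close>; the comparison is settled by evaluation.\<close>

fun link_reps :: "letter trie \<Rightarrow> int \<Rightarrow> (int \<times> letter) list \<Rightarrow> coset_table \<Rightarrow> coset_table" where
  "link_reps ws k [] t = t"
| "link_reps ws k ((p, x) # ps) t =
    link_reps ws (k + 1) ps 
      (link (if get ws k = get ws p @ [x] then Some p else None) x (Some k) t)"

fun link_subgroup :: "letter list \<Rightarrow> coset_table \<Rightarrow> coset_table" where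
  "link_subgroup [] t = t"
| "link_subgroup (x # xs) t = link_subgroup xs (link (Some 1) x (Some 1) t)"

text \<open>Numbering starts at 2: coset 1 is the subgroup itself, represented by the default entry
  \<open>[]\<close>.\<close>

definition coset_reps :: "(int \<times> letter) list \<Rightarrow> letter trie" where
  "coset_reps ps = add_reps 2 ps Leaf"

definition coset_table ::
  "letter list \<Rightarrow> (int \<times> letter) list \<Rightarrow> (int \<times> nat \<times> nat) list \<Rightarrow> coset_table" where
  "coset_table X ps ds =
    deduce_all ds (link_reps (coset_reps ps) 2 ps (link_subgroup X Leaf))"

fun complete_row :: "int \<Rightarrow> letter list \<Rightarrow> (letter \<times> int) list \<Rightarrow> bool" where
  "complete_row n Y e \<longleftrightarrow>
    (\<forall>y\<in>set Y. case map_of e y of None \<Rightarrow> False | Some j \<Rightarrow> 1 \<le> j \<and> j \<le> n)"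

fun complete_rows :: "int \<Rightarrow> letter list \<Rightarrow> int list \<Rightarrow> coset_table \<Rightarrow> bool" where
  "complete_rows n Y [] t = True"
| "complete_rows n Y (i # is) t = (complete_row n Y (get t i) \<and> complete_rows n Y is t)"

definition complete_table :: "letter list \<Rightarrow> int \<Rightarrow> coset_table \<Rightarrow> bool" where
  "complete_table Y n t = complete_rows n Y [1..n] t"

lemma complete_rows_iff: "complete_rows n Y is t \<longleftrightarrow> (\<forall>i\<in>set is. complete_row n Y (get t i))"
  by (induction n Y "is" t rule: complete_rows.induct) simp_all

text \<open>If \<open>X\<close> is closed under \<open>linv\<close>, the words over \<open>X\<close>
  represent the whole subgroup \<open>K\<close> that it generates, and this is the equality
  \<open>K v = K w\<close>.\<close>

definition same_coset :: "letter list \<Rightarrow> letter list \<Rightarrow> letter list \<Rightarrow> bool" where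
  "same_coset X v w \<longleftrightarrow> (\<exists>k. set k \<subseteq> set X \<and> v \<approx> k @ w)"

lemma same_coset_equ: "v \<approx> w \<Longrightarrow> same_coset X v w"
  unfolding same_coset_def by (rule exI[of _ "[]"]) simp

lemma same_coset_trans:
  assumes "same_coset X u v" "same_coset X v w"
  shows "same_coset X u w"
proof -
  obtain k k' where k: "set k \<subseteq> set X" "u \<approx> k @ v" "set k' \<subseteq> set X" "v \<approx> k' @ w"
    using assms by (auto simp: same_coset_def)
  have "u \<approx> k @ k' @ w"
    using k(2) equ_append[OF equ_refl k(4)] by (rule equ_trans)
  with k show ?thesis
    unfolding same_coset_def by (intro exI[of _ "k @ k'"]) simp
qed

lemma set_winv: "set (winv w) = linv ` set w"
  by (simp add: winv_def)

lemma same_coset_sym: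
  assumes "linv ` set X \<subseteq> set X" "same_coset X v w"
  shows "same_coset X w v"
proof -
  obtain k where k: "set k \<subseteq> set X" "v \<approx> k @ w"
    using assms by (auto simp: same_coset_def)
  have "w \<approx> winv k @ v"
    using equ_solve_left[OF equ_sym[OF k(2)]] .
  moreover have "set (winv k) \<subseteq> set X"
    using assms(1) k(1) by (auto simp: set_winv)
  ultimately show ?thesis unfolding same_coset_def by blast
qed

lemma same_coset_append:
  assumes "same_coset X v w"
  shows "same_coset X (v @ z) (w @ z)"
proof -
  obtain k where "set k \<subseteq> set X" "v \<approx> k @ w"
    using assms by (auto simp: same_coset_def)
  with equ_append[OF this(2) equ_refl[of z]] show ?thesis
    unfolding same_coset_def by auto
qed

definition valid_table :: "letter list \<Rightarrow> letter trie \<Rightarrow> coset_table \<Rightarrow> bool" where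
  "valid_table X ws t \<longleftrightarrow>
    (\<forall>i x j. (x, j) \<in> set (get t i) \<longrightarrow> same_coset X (get ws i @ [x]) (get ws j))"

section \<open>Soundness of the enumeration steps\<close>

context
  fixes X :: "letter list" and ws :: "letter trie"
  assumes closed: "linv ` set X \<subseteq> set X"
    and first: "get ws 1 = []"
begin

lemma valid_link:
  assumes "valid_table X ws t" "same_coset X (get ws i @ [x]) (get ws j)"
  shows "valid_table X ws (link (Some i) x (Some j) t)"
proof -
  have "same_coset X (get ws j @ [linv x]) (get ws i @ [x] @ [linv x])"
    using same_coset_append[OF same_coset_sym[OF closed assms(2)], of "[linv x]"] by simp
  moreover have "get ws i @ [x] @ [linv x] \<approx> get ws i @ []"
    using equ_append[OF equ_refl equ_linv, of "get ws i" x] by simp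
  ultimately have "same_coset X (get ws j @ [linv x]) (get ws i)"
    using same_coset_trans same_coset_equ by fastforce
  then show ?thesis
    using assms unfolding valid_table_def
    by (auto simp: add_entry_def get_put split: if_splits)
qed

lemma same_coset_trace:
  assumes "valid_table X ws t" "trace t (Some i) w = Some j"
  shows "same_coset X (get ws i @ w) (get ws j)"
  using assms(2)
proof (induction w arbitrary: i)
  case Nil
  then show ?case by (simp add: same_coset_equ)
next
  case (Cons x w)
  then obtain l where l: "map_of (get t i) x = Some l" "trace t (Some l) w = Some j"
    by (cases "map_of (get t i) x") auto
  have "same_coset X (get ws i @ [x]) (get ws l)"
    using assms(1) map_of_SomeD[OF l(1)] by (simp add: valid_table_def)
  from same_coset_append[OF this, of w] Cons.IH[OF l(2)] show ?case
    using same_coset_trans by fastforce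
qed

text \<open>Splitting a relator as \<open>u x v'\<close> gives
  \<open>w\<^sub>i u x = w\<^sub>i v'\<inverse>\<close>. Tracing both \<open>u\<close> and
  \<open>v'\<inverse>\<close> from coset \<open>i\<close> therefore yields two cosets joined by
  \<open>x\<close>.\<close>

lemma valid_deduce:
  assumes t: "valid_table X ws t" and relator: "u @ v = [] \<or> u @ v \<in> set relators"
  shows "valid_table X ws (deduce i u v t)"
proof (cases "deduce i u v t = t")
  case False
  then obtain x v' where v: "v = x # v'"
    by (cases v) auto
  \<comment> \<open>A failed trace would make \<open>link\<close> return the table
    unchanged.\<close>
  with False obtain f b
    where *: "trace t (Some i) u = Some f" "trace t (Some i) (winv v') = Some b"
    by (cases "trace t (Some i) u"; cases "trace t (Some i) (winv v')") auto
  have "(u @ [x]) @ v' \<approx> []"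
    using relator relator_equ by (auto simp: v)
  from equ_append[OF equ_refl[of "get ws i"] equ_solve_right[OF this]]
  have "same_coset X (get ws i @ u @ [x]) (get ws i @ winv v')"
    by (simp add: same_coset_equ)
  moreover have "same_coset X (get ws f @ [x]) (get ws i @ u @ [x])"
    by (rule same_coset_append[OF same_coset_sym[OF closed same_coset_trace[OF t *(1)]],
          of "[x]", unfolded append_assoc])
  moreover have "same_coset X (get ws i @ winv v') (get ws b)"
    by (rule same_coset_trace[OF t *(2)])
  ultimately have "same_coset X (get ws f @ [x]) (get ws b)"
    by (metis same_coset_trans)
  then show ?thesis
    using valid_link[OF t] by (simp add: v *)
qed (use t in simp)

lemma valid_deduce_all:
  "valid_table X ws t \<Longrightarrow> valid_table X ws (deduce_all ds t)"
proof (induction ds arbitrary: t)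
  case (Cons d ds)
  obtain i k p where d: "d = (i, k, p)" by (cases d)
  have "take p (relator k) @ drop p (relator k) = [] \<or>
      take p (relator k) @ drop p (relator k) \<in> set relators"
    by (simp add: relator_def)
  from Cons.IH[OF valid_deduce[OF Cons.prems this]] show ?case
    by (simp add: d)
qed simp

lemma valid_link_reps:
  "valid_table X ws t \<Longrightarrow> valid_table X ws (link_reps ws k ps t)"
proof (induction ps arbitrary: k t)
  case (Cons a ps)
  obtain p x where a: "a = (p, x)" by (cases a)
  let ?p = "if get ws k = get ws p @ [x] then Some p else None"
  have "valid_table X ws (link ?p x (Some k) t)"
    using Cons.prems by (simp add: valid_link same_coset_equ del: link.simps(1))
  from Cons.IH[OF this] show ?case by (simp only: a link_reps.simps)
qed simp

lemma valid_link_subgroup: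
  assumes "set xs \<subseteq> set X" "valid_table X ws t"
  shows "valid_table X ws (link_subgroup xs t)"
  using assms
proof (induction xs arbitrary: t)
  case (Cons x xs)
  have "same_coset X ([] @ [x]) []"
    using Cons.prems unfolding same_coset_def by (intro exI[of _ "[x]"]) simp
  with Cons show ?case by (simp add: valid_link first del: link.simps(1))
qed simp

end

lemma get_Leaf: "get Leaf i = []"
  by (simp add: get_def)

lemma get_add_reps: "j < k \<Longrightarrow> get (add_reps k ps ws) j = get ws j"
  by (induction k ps ws rule: add_reps.induct) (simp_all add: get_put)

lemma get_coset_reps_1: "get (coset_reps ps) 1 = []"
  by (simp add: coset_reps_def get_add_reps get_Leaf)

text \<open>Valid for arbitrary \<open>ps\<close> and \<open>ds\<close>: the certificates are not
  trusted, and a bad one could only leave the table incomplete or the cosets unseparated.\<close>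

lemma valid_coset_table:
  assumes "linv ` set X \<subseteq> set X"
  shows "valid_table X (coset_reps ps) (coset_table X ps ds)"
proof -
  have "valid_table X (coset_reps ps) Leaf"
    by (simp add: valid_table_def get_Leaf)
  then show ?thesis
    unfolding coset_table_def
    by (intro valid_deduce_all valid_link_reps valid_link_subgroup assms get_coset_reps_1
        subset_refl)
qed

text \<open>The first \<open>n\<close> cosets include that of the empty word and are closed under
  right multiplication by letters of \<open>Y\<close>. They may coincide, so \<open>n\<close> only
  bounds the index from above.\<close>

lemma coset_cover:
  assumes "valid_table X ws t" "complete_table Y n t" "get ws 1 = []" "1 \<le> n"
    and "set w \<subseteq> set Y"
  shows "\<exists>i\<in>{1..n}. same_coset X w (get ws i)"
  using assms(5)
proof (induction w rule: rev_induct)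
  case Nil
  show ?case
    using assms(3,4) by (intro bexI[of _ 1]) (simp_all add: same_coset_equ)
next
  case (snoc y w)
  then obtain i where i: "i \<in> {1..n}" "same_coset X w (get ws i)" by auto
  have "case map_of (get t i) y of None \<Rightarrow> False | Some j \<Rightarrow> 1 \<le> j \<and> j \<le> n"
    using assms(2) snoc.prems i(1) by (simp add: complete_table_def complete_rows_iff)
  then obtain j where j: "map_of (get t i) y = Some j" "j \<in> {1..n}"
    by (cases "map_of (get t i) y") auto
  have "same_coset X (get ws i @ [y]) (get ws j)"
    using assms(1) map_of_SomeD[OF j(1)] by (simp add: valid_table_def)
  with same_coset_append[OF i(2), of "[y]"] have "same_coset X (w @ [y]) (get ws j)"
    by (rule same_coset_trans)
  with j(2) show ?case by blast
qed


section \<open>The permutation action over a computable model of the field\<close>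

text \<open>\<open>Fz\<close> and \<open>Fz'\<close> stand for \<open>\<zeta>\<close> and \<open>\<zeta>\<^sup>2\<close>.\<close>

datatype gf4 = F0 | F1 | Fz | Fz'

fun gadd :: "gf4 \<Rightarrow> gf4 \<Rightarrow> gf4" where
  "gadd F0 b = b"
| "gadd a F0 = a"
| "gadd F1 Fz = Fz'"
| "gadd F1 Fz' = Fz"
| "gadd Fz F1 = Fz'"
| "gadd Fz Fz' = F1"
| "gadd Fz' F1 = Fz"
| "gadd Fz' Fz = F1"
| "gadd _ _ = F0"

fun gmul :: "gf4 \<Rightarrow> gf4 \<Rightarrow> gf4" where
  "gmul F0 _ = F0"
| "gmul _ F0 = F0"
| "gmul F1 b = b"
| "gmul a F1 = a"
| "gmul Fz Fz = Fz'"
| "gmul Fz' Fz' = Fz"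
| "gmul _ _ = F1"

fun ginv :: "gf4 \<Rightarrow> gf4" where
  "ginv Fz = Fz'"
| "ginv Fz' = Fz"
| "ginv a = a"

text \<open>
  \<open>Aff a b\<close>, \<open>Inf a\<close> and \<open>Vert\<close> are \<open>[1, a, b]\<close>, \<open>[0, 1, a]\<close> and \<open>[0, 0, 1]\<close>; the new point \<open>New\<close> takes
  the place of the zero vector.
\<close>

datatype pnt = New | Aff gf4 gf4 | Inf gf4 | Vert

fun coords :: "pnt \<Rightarrow> gf4 \<times> gf4 \<times> gf4" where
  "coords New = (F0, F0, F0)"
| "coords (Aff a b) = (F1, a, b)"
| "coords (Inf a) = (F0, F1, a)"
| "coords Vert = (F0, F0, F1)"

fun normal_form :: "gf4 \<times> gf4 \<times> gf4 \<Rightarrow> pnt" where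
  "normal_form (x, y, z) =
    (if x \<noteq> F0 then Aff (gmul (ginv x) y) (gmul (ginv x) z)
     else if y \<noteq> F0 then Inf (gmul (ginv y) z)
     else if z \<noteq> F0 then Vert else New)"

fun transform :: "letter \<Rightarrow> gf4 \<times> gf4 \<times> gf4 \<Rightarrow> gf4 \<times> gf4 \<times> gf4" where
  "transform S (x, y, z) = (gadd x y, y, z)"
| "transform J (x, y, z) = (y, x, z)"
| "transform T (x, y, z) = (z, y, x)"
| "transform R (x, y, z) = (gmul Fz x, y, gmul Fz' z)"
| "transform R' (x, y, z) = (gmul Fz' x, y, gmul Fz z)"
| "transform U (x, y, z) = (gadd (gmul x x) (gmul y z), gmul y y, gmul z z)"

text \<open>\<open>Aff F0 F0\<close> is the point [1, 0, 0], which \<open>U\<close> exchanges with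
  \<open>New\<close>. The linear letters fix \<open>New\<close> because they fix the zero
  vector.\<close>

definition act :: "letter \<Rightarrow> pnt \<Rightarrow> pnt" where
  "act x p =
    (if x = U \<and> p = New then Aff F0 F0
     else if x = U \<and> p = Aff F0 F0 then New
     else normal_form (transform x (coords p)))"

text \<open>The right fold lets the last letter act first, in agreement with composition from right
  to left.\<close>

definition word_act :: "letter list \<Rightarrow> pnt \<Rightarrow> pnt" where
  "word_act w p = foldr act w p"

definition pnts :: "pnt list" where
  "pnts = New # Vert # map Inf [F0, F1, Fz, Fz'] @
    map (\<lambda>(a, b). Aff a b) (List.product [F0, F1, Fz, Fz'] [F0, F1, Fz, Fz'])"

lemma in_pnts: "p \<in> set pnts"
proof -
  have F: "a \<in> set [F0, F1, Fz, Fz']" for a by (cases a) simp_all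
  show ?thesis
  proof (cases p)
    case (Aff a b)
    then show ?thesis using F[of a] F[of b] by (auto simp: pnts_def)
  next
    case (Inf a)
    then show ?thesis using F[of a] by (auto simp: pnts_def)
  qed (simp_all add: pnts_def)
qed

section \<open>The action respects the relations\<close>

lemma word_act_simps [simp]:
  "word_act [] p = p" "word_act (x # w) p = act x (word_act w p)"
  "word_act (v @ w) p = word_act v (word_act w p)"
  by (simp_all add: word_act_def)

text \<open>Both sides of the 17 relations are evaluated at all 22 points.\<close>

lemma word_act_relations:
  "\<forall>(a, b)\<in>m22_relations. \<forall>p\<in>set pnts. word_act (letters_of a) p = word_act (letters_of b) p"
  by code_simp

lemma act_linv: "act x (act (linv x) p) = p"
proof -
  have "\<forall>x\<in>set [S, J, T, R, R', U]. \<forall>p\<in>set pnts. act x (act (linv x) p) = p"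
    by code_simp
  moreover have "x \<in> set [S, J, T, R, R', U]" by (cases x) simp_all
  ultimately show ?thesis using in_pnts by blast
qed

lemma word_act_cong:
  "word_equiv m22_relations v w \<Longrightarrow> word_act (letters_of v) = word_act (letters_of w)"
proof (induction rule: word_equiv.induct)
  case (relation v w)
  with word_act_relations in_pnts show ?case by fast
next
  case (cancel x b)
  have "letter_of (x, \<not> b) = linv (letter_of (x, b))" by (cases x) auto
  then show ?case by (simp add: fun_eq_iff act_linv)
qed (simp_all add: fun_eq_iff)

lemma word_act_equ: "v \<approx> w \<Longrightarrow> word_act v = word_act w"
  using word_act_cong[of "of_letters v" "of_letters w"]
  by (simp only: equ_def letters_of_inverse)

section \<open>Descent to a subgroup\<close>

definition separated :: "letter list \<Rightarrow> pnt list list \<Rightarrow> int \<Rightarrow> letter trie \<Rightarrow> bool" where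
  "separated X Ls n ws \<longleftrightarrow>
    (\<forall>x\<in>set X. \<forall>L\<in>set Ls. \<forall>p\<in>set L. act x p \<in> set L) \<and>
    (\<forall>i\<in>set [2..n]. \<exists>L\<in>set Ls. \<exists>p\<in>set L. word_act (get ws i) p \<notin> set L)"

text \<open>A word \<open>w\<close> lies in some coset, say \<open>w = k w\<^sub>i\<close> with
  \<open>k\<close> over \<open>X\<close>. If \<open>w\<close> acts trivially,
  \<open>w\<^sub>i\<close> acts as \<open>k\<inverse>\<close> and preserves every set in
  \<open>Ls\<close>, whereas the representatives from 2 on each violate one of them. Hence
  \<open>i = 1\<close> and \<open>w = k\<close>.\<close>

lemma trivial_action_descends:
  assumes X: "\<forall>x\<in>set X. linv x \<in> set X"
    and complete: "complete_table Y n (coset_table X ps ds)" and n: "1 \<le> n"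
    and separated: "separated X Ls n (coset_reps ps)"
    and w: "set w \<subseteq> set Y" "\<forall>p. word_act w p = p"
  shows "\<exists>k. set k \<subseteq> set X \<and> w \<approx> k"
proof -
  let ?ws = "coset_reps ps"
  have X': "linv ` set X \<subseteq> set X" using X by blast
  obtain i k where i: "i \<in> {1..n}" and k: "set k \<subseteq> set X" "w \<approx> k @ get ?ws i"
    using coset_cover[OF valid_coset_table[OF X'] complete get_coset_reps_1 n w(1)]
    by (auto simp: same_coset_def)
  have "i = 1"
  proof (rule ccontr)
    assume "i \<noteq> 1"
    with i have "i \<in> set [2..n]" by auto
    with separated obtain L p
      where L: "L \<in> set Ls" "p \<in> set L" "word_act (get ?ws i) p \<notin> set L"
      unfolding separated_def by blast
    have stab: "word_act v q \<in> set L" if "set v \<subseteq> set X" "q \<in> set L" for v q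
      using that(1)
    proof (induction v)
      case (Cons x v)
      with separated L(1) show ?case by (simp add: separated_def)
    qed (simp add: that(2))
    have "get ?ws i \<approx> winv k @ w"
      using equ_solve_left[OF equ_sym[OF k(2)]] .
    then have "word_act (get ?ws i) p = word_act (winv k) p"
      using w(2) by (simp add: word_act_equ)
    moreover have "set (winv k) \<subseteq> set X"
      using X' k(1) by (auto simp: set_winv)
    ultimately show False
      using stab L(2,3) by simp
  qed
  with k show ?thesis
    by (auto simp: get_coset_reps_1)
qed


section \<open>Faithfulness of the action\<close>

text \<open>
  The following certificates were found by a computer search. A tree lists, for the cosets \<open>2, 3, \<dots>\<close>, how
  the representative extends an earlier one by a letter. Only the first 22 of the 27 cosets in
  \<open>m22_coset_tree\<close> are distinct; the others serve for intermediate deductions.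
\<close>

(* Coercion inference is very slow on the large literals. *)
declare [[coercion_enabled = false]]

definition m22_coset_tree :: "(int \<times> letter) list" where
  "m22_coset_tree =
    [(1, U), (2, J), (2, T), (3, S), (5, R'), (5, R), (5, T), (6, T), (7, T), (8, S), (8, J), (9,
    S), (9, U), (9, J), (10, S), (10, U), (10, J), (13, U), (13, R'), (16, U), (16, R), (3, T),
    (4, U), (4, J), (24, J), (24, T)]"

definition m22_coset_steps :: "(int \<times> nat \<times> nat) list" where
  "m22_coset_steps =
    [(5, 3, 1), (5, 5, 1), (6, 5, 1), (7, 5, 1), (8, 4, 1), (9, 4, 1), (10, 4, 1), (1, 12, 1),
    (9, 12, 1), (10, 12, 1), (10, 6, 2), (2, 7, 2), (5, 4, 2), (5, 8, 2), (6, 8, 2), (1, 13, 2),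
    (3, 12, 2), (1, 14, 1), (2, 14, 4), (5, 14, 2), (10, 14, 1), (2, 5, 1), (3, 6, 2), (1, 15,
    2), (1, 16, 3), (4, 7, 0), (2, 8, 4), (11, 15, 0), (8, 14, 1), (9, 14, 1), (8, 6, 3), (9, 6,
    1), (13, 3, 1), (16, 3, 1), (3, 15, 5), (11, 5, 2), (13, 15, 1), (16, 15, 1), (16, 5, 0),
    (19, 5, 2), (6, 15, 4), (7, 15, 4), (2, 9, 8), (11, 4, 2), (8, 7, 1), (8, 13, 4), (9, 13, 4),
    (4, 16, 0), (2, 10, 11), (5, 10, 11), (9, 10, 6), (13, 10, 3), (16, 10, 3), (15, 12, 3)]"

definition psl_coset_tree :: "(int \<times> letter) list" where
  "psl_coset_tree =
    [(1, T), (2, J), (2, S), (3, S), (4, R'), (4, T), (4, R), (4, J), (5, R), (5, T), (5, R'),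
    (5, J), (6, J), (6, T), (7, R'), (7, J), (8, J), (18, S), (18, T), (9, T), (10, T), (10, J),
    (11, J), (11, R), (11, S), (12, J), (15, J), (13, T), (29, J), (29, R), (29, S), (29, R'),
    (22, J), (22, S), (14, T), (14, S), (30, R'), (30, R), (16, J), (17, T), (17, S), (19, R'),
    (19, R), (19, T), (23, S), (32, R), (32, T), (32, R'), (20, J), (20, S), (51, R), (51, T),
    (51, J), (51, R'), (21, S), (24, R'), (24, S), (25, S), (26, R'), (26, R), (58, R), (58, J),
    (58, R'), (58, T), (28, T), (28, S), (34, S), (31, S), (35, R'), (35, J), (35, R), (60, S),
    (60, J), (33, S), (36, S), (37, R'), (37, T), (64, T), (64, J), (64, S), (40, S), (41, S),
    (42, R), (42, R'), (83, R'), (83, J), (83, R), (43, T), (44, T), (85, S), (67, R'), (67, T),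
    (67, R), (68, R'), (68, J), (68, T), (45, S), (45, J), (46, T), (47, T), (47, S), (49, S),
    (50, S), (52, J), (52, T), (52, S), (53, J), (53, R), (53, S), (96, T), (96, R'), (96, R),
    (101, S), (77, T), (54, T), (54, S), (54, R), (72, J), (72, S), (56, J), (56, R), (57, S),
    (59, J), (75, R), (75, T), (62, J), (62, T), (62, S), (65, J), (66, S), (69, R'), (69, T),
    (80, S), (74, S), (76, R'), (76, J), (78, S), (78, J), (79, J), (81, T), (82, T), (82, R'),
    (86, J), (87, R'), (119, S), (106, S), (89, S), (89, J), (90, J), (90, S), (93, R'), (93, J),
    (95, T), (97, J), (98, J), (98, R'), (98, R), (99, S), (100, J), (100, S), (124, R), (105,
    T), (105, S), (107, J), (108, T), (110, R'), (110, J), (110, R), (111, J), (115, S), (115,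
    J), (112, S), (114, J), (114, R), (114, T), (116, R'), (116, S), (175, J), (175, S), (117,
    R'), (160, S), (158, S), (158, J), (118, S), (168, R'), (150, S), (128, J), (121, R'), (170,
    S), (170, R'), (189, S), (123, T), (127, S), (129, T), (130, S), (131, J), (131, R'), (133,
    S), (134, T), (137, T), (197, T), (197, R'), (138, R'), (138, R), (138, J), (139, S), (140,
    S), (141, J), (209, S), (144, S), (145, S), (147, T), (147, R'), (148, R), (148, R'), (148,
    J), (207, R'), (207, R), (207, J), (207, T), (149, S), (151, J), (151, R), (153, S), (155,
    S), (156, R), (156, S), (159, T), (159, R), (159, R'), (161, J), (161, R'), (163, S), (164,
    J), (164, T), (164, R), (171, J), (172, S), (222, J), (222, R), (222, R'), (187, R), (187,
    J), (176, J), (244, T), (244, R), (244, R'), (177, S), (178, R'), (178, T), (178, R), (251,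
    R), (251, R'), (251, S), (251, J), (181, S), (182, R), (182, R'), (182, J), (183, J), (184,
    T), (184, S), (220, R), (220, R'), (185, R'), (188, S), (190, R), (190, R'), (191, S), (192,
    R), (219, S), (232, R'), (232, R), (196, R'), (196, R), (248, S), (200, J), (201, S), (225,
    T), (242, J), (203, S), (234, T), (234, R), (271, S), (254, S), (254, J), (205, J), (208, R),
    (208, T), (208, R'), (210, R'), (210, R), (258, J), (226, T), (226, R), (226, R'), (215, J),
    (223, R'), (227, S), (228, R), (228, R'), (294, S), (294, R'), (296, S), (296, T), (288, S),
    (263, R), (263, R'), (252, S), (238, S), (306, S), (236, S), (245, S), (249, R), (253, S),
    (289, T), (289, S), (313, J), (313, R'), (314, J), (264, S), (318, R'), (267, T), (273, S),
    (279, T), (279, R), (274, S), (280, S), (278, S), (281, S), (319, R), (327, T), (328, R'),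
    (298, S), (329, R)]"

definition psl_coset_steps :: "(int \<times> nat \<times> nat) list" where
  "psl_coset_steps =
    [(4, 3, 1), (5, 3, 1), (19, 3, 1), (26, 3, 1), (29, 3, 1), (30, 3, 1), (32, 3, 1), (35, 3,
    1), (42, 3, 1), (51, 3, 1), (58, 3, 1), (67, 3, 1), (83, 3, 1), (96, 3, 1), (98, 3, 1), (110,
    3, 1), (138, 3, 1), (148, 3, 1), (159, 3, 1), (178, 3, 1), (182, 3, 1), (190, 3, 1), (196, 3,
    1), (207, 3, 1), (208, 3, 1), (210, 3, 1), (220, 3, 1), (222, 3, 1), (226, 3, 1), (228, 3,
    1), (232, 3, 1), (244, 3, 1), (251, 3, 1), (263, 3, 1), (4, 4, 1), (5, 4, 1), (6, 4, 1), (9,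
    3, 2), (7, 4, 1), (10, 4, 1), (13, 3, 1), (24, 4, 2), (29, 4, 2), (30, 4, 2), (51, 4, 2),
    (52, 4, 1), (54, 3, 1), (58, 4, 1), (62, 4, 1), (63, 3, 1), (68, 4, 2), (71, 4, 3), (83, 4,
    1), (87, 3, 1), (86, 4, 2), (98, 4, 2), (121, 4, 2), (156, 4, 3), (156, 3, 1), (161, 4, 2),
    (168, 4, 2), (174, 4, 3), (205, 4, 1), (207, 4, 2), (215, 4, 1), (218, 4, 2), (222, 4, 1),
    (223, 4, 2), (243, 4, 0), (251, 4, 1), (258, 4, 1), (260, 3, 0), (182, 4, 2), (313, 4, 2),
    (1, 5, 1), (2, 4, 1), (4, 5, 1), (7, 3, 1), (15, 4, 1), (17, 3, 1), (5, 5, 2), (6, 5, 2), (9,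
    5, 1), (10, 5, 1), (11, 3, 1), (11, 4, 1), (24, 3, 1), (13, 5, 2), (14, 5, 1), (20, 3, 0),
    (17, 5, 1), (19, 5, 1), (89, 4, 1), (23, 5, 2), (37, 5, 1), (115, 4, 1), (43, 5, 1), (45, 3,
    2), (45, 4, 1), (99, 3, 1), (47, 5, 1), (51, 5, 2), (52, 5, 1), (53, 3, 1), (54, 5, 1), (116,
    3, 1), (58, 5, 1), (79, 4, 1), (62, 5, 1), (65, 3, 1), (65, 4, 1), (130, 3, 1), (68, 5, 1),
    (93, 5, 2), (105, 5, 2), (178, 5, 2), (250, 5, 2), (289, 5, 1), (295, 5, 3), (326, 5, 3), (2,
    6, 2), (3, 6, 2), (11, 6, 2), (17, 6, 2), (18, 6, 2), (20, 6, 3), (56, 3, 1), (56, 4, 1),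
    (121, 3, 1), (21, 6, 2), (22, 6, 3), (59, 4, 2), (24, 6, 3), (123, 5, 1), (25, 6, 1), (59, 3,
    1), (28, 6, 2), (29, 6, 3), (75, 3, 1), (31, 6, 1), (69, 3, 1), (33, 6, 2), (34, 6, 1), (68,
    3, 1), (81, 4, 0), (81, 5, 1), (97, 3, 1), (97, 4, 1), (40, 6, 1), (82, 3, 1), (45, 6, 3),
    (151, 3, 1), (151, 4, 1), (223, 3, 1), (53, 6, 2), (89, 6, 2), (90, 6, 2), (99, 6, 2), (105,
    6, 2), (116, 6, 3), (249, 3, 1), (117, 6, 3), (185, 3, 1), (130, 6, 2), (139, 6, 3), (140, 6,
    3), (267, 3, 0), (150, 6, 2), (156, 6, 2), (163, 6, 2), (188, 6, 2), (209, 6, 2), (2, 7, 3),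
    (9, 6, 2), (13, 6, 3), (37, 3, 1), (46, 5, 1), (78, 3, 1), (78, 4, 1), (139, 3, 1), (78, 6,
    2), (160, 6, 2), (6, 7, 2), (19, 4, 2), (37, 4, 2), (20, 7, 2), (22, 7, 3), (45, 7, 2), (159,
    4, 2), (228, 4, 2), (52, 7, 3), (189, 6, 3), (235, 4, 2), (64, 7, 2), (78, 7, 3), (206, 6,
    3), (89, 7, 3), (217, 6, 3), (90, 7, 3), (100, 7, 3), (260, 6, 3), (303, 3, 0), (115, 7, 2),
    (157, 7, 2), (205, 7, 2), (303, 4, 0), (231, 7, 2), (1, 8, 2), (4, 8, 3), (20, 4, 1), (41, 3,
    1), (21, 4, 2), (28, 5, 2), (21, 7, 3), (87, 6, 3), (212, 3, 0), (121, 6, 3), (192, 3, 1),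
    (36, 7, 3), (5, 8, 2), (24, 5, 2), (30, 5, 2), (19, 8, 2), (99, 5, 2), (139, 5, 2), (51, 8,
    3), (68, 8, 2), (170, 5, 2), (11, 10, 18), (124, 3, 2), (73, 4, 0), (69, 5, 2), (103, 5, 0),
    (60, 7, 2), (2, 10, 13), (106, 6, 1), (147, 3, 1), (109, 6, 2), (25, 7, 2), (106, 4, 0), (53,
    4, 1), (108, 3, 2), (108, 5, 1), (166, 3, 2), (116, 4, 2), (163, 4, 0), (57, 6, 2), (53, 7,
    3), (71, 6, 3), (146, 3, 0), (110, 4, 2), (62, 7, 2), (194, 4, 3), (3, 10, 6), (31, 7, 4),
    (69, 4, 2), (59, 8, 0), (73, 5, 0), (6, 10, 1), (15, 7, 2), (67, 4, 2), (67, 8, 2), (6, 9,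
    7), (138, 5, 2), (168, 5, 2), (18, 9, 6), (1, 10, 7), (67, 5, 1), (93, 3, 1), (104, 4, 1),
    (117, 3, 1), (93, 4, 2), (153, 5, 2), (41, 6, 2), (50, 6, 2), (54, 6, 3), (164, 3, 1), (164,
    4, 2), (164, 5, 1), (280, 6, 2), (18, 10, 6), (163, 7, 4), (21, 10, 14), (234, 3, 1), (234,
    4, 2), (283, 5, 2), (177, 6, 2), (97, 10, 15), (244, 5, 1), (170, 6, 2), (38, 10, 21), (30,
    6, 2), (29, 7, 4), (32, 4, 2), (33, 7, 4), (75, 4, 2), (218, 10, 0), (187, 5, 3), (187, 3,
    1), (187, 4, 2), (218, 5, 2), (149, 6, 2), (31, 10, 17), (71, 5, 0), (75, 5, 1), (71, 3, 0),
    (35, 4, 2), (35, 8, 0), (35, 5, 2), (22, 9, 6), (166, 6, 0), (116, 7, 4), (178, 4, 2), (177,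
    7, 4), (249, 4, 2), (178, 8, 2), (25, 9, 6), (97, 6, 4), (97, 7, 2), (226, 4, 2), (141, 7,
    2), (210, 4, 2), (34, 9, 11), (36, 6, 1), (76, 3, 1), (111, 4, 1), (137, 3, 0), (76, 4, 2),
    (96, 5, 2), (76, 5, 0), (137, 5, 1), (155, 3, 1), (141, 4, 2), (155, 6, 3), (279, 3, 1),
    (191, 6, 1), (246, 3, 2), (246, 5, 2), (201, 6, 2), (55, 7, 2), (185, 4, 2), (190, 4, 2),
    (122, 7, 2), (192, 4, 2), (211, 4, 2), (154, 7, 2), (279, 4, 2), (187, 8, 2), (211, 5, 0),
    (192, 5, 0), (14, 9, 10), (98, 5, 2), (110, 5, 2), (98, 8, 4), (156, 5, 1), (206, 3, 1),
    (138, 4, 2), (184, 5, 2), (8, 9, 1), (7, 6, 0), (7, 7, 2), (42, 4, 2), (16, 7, 2), (82, 4,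
    2), (1, 9, 5), (42, 5, 2), (83, 5, 2), (42, 8, 2), (87, 5, 2), (4, 9, 8), (26, 4, 1), (48, 3,
    1), (48, 4, 2), (32, 5, 2), (63, 6, 0), (48, 6, 3), (114, 3, 1), (114, 4, 1), (173, 3, 0),
    (114, 5, 1), (200, 4, 1), (96, 6, 2), (101, 6, 3), (135, 3, 1), (135, 4, 2), (112, 6, 2),
    (26, 8, 0), (26, 5, 2), (2, 9, 10), (56, 5, 2), (63, 5, 2), (56, 8, 4), (121, 5, 2), (130, 5,
    2), (3, 9, 6), (65, 7, 2), (196, 4, 2), (10, 9, 6), (115, 6, 1), (171, 3, 2), (171, 4, 1),
    (238, 3, 2), (134, 5, 2), (176, 7, 3), (12, 9, 7), (135, 5, 2), (180, 5, 2), (21, 9, 10),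
    (196, 5, 2), (23, 9, 10), (148, 5, 2), (174, 5, 2), (114, 8, 2), (217, 5, 2), (27, 9, 10),
    (161, 5, 2), (147, 5, 1), (161, 3, 0), (213, 4, 0), (100, 6, 2), (200, 7, 2), (135, 8, 2),
    (232, 5, 2), (223, 5, 0), (31, 9, 5), (182, 5, 2), (222, 5, 2), (36, 9, 9), (232, 6, 3),
    (325, 3, 0), (279, 5, 2), (273, 6, 2), (38, 9, 6), (244, 6, 3), (277, 3, 0), (263, 4, 0),
    (295, 4, 2), (226, 5, 2), (226, 8, 2), (263, 5, 2), (39, 9, 5), (249, 8, 2), (52, 9, 9),
    (184, 6, 3), (290, 3, 1), (317, 4, 0), (208, 5, 2), (227, 6, 2), (62, 9, 1), (65, 6, 2), (79,
    7, 2), (208, 4, 2), (128, 7, 2), (267, 4, 2), (289, 8, 2), (69, 9, 5), (190, 5, 2), (260, 5,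
    2), (182, 8, 2), (185, 5, 2), (15, 10, 7), (91, 5, 1), (131, 3, 1), (142, 4, 0), (82, 5, 2),
    (66, 6, 2), (82, 8, 2), (197, 5, 1), (197, 3, 0), (131, 4, 2), (137, 6, 2), (51, 9, 5), (212,
    5, 2), (228, 5, 2), (159, 8, 1), (54, 9, 4), (223, 6, 4), (248, 6, 3), (256, 3, 1), (253, 4,
    0), (256, 5, 2), (216, 7, 0), (148, 4, 1), (217, 3, 1), (245, 5, 2), (240, 6, 5), (240, 3,
    1), (240, 4, 2), (240, 5, 2), (253, 6, 1), (316, 3, 2), (290, 4, 0), (316, 5, 0), (20, 9, 6),
    (172, 6, 1), (229, 3, 0), (229, 4, 1), (236, 3, 2), (236, 4, 0), (159, 5, 2), (225, 5, 2),
    (229, 5, 2), (236, 6, 1), (313, 3, 1), (314, 4, 1), (319, 3, 1), (249, 5, 2), (310, 5, 2),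
    (319, 5, 0), (220, 6, 4), (245, 6, 3), (329, 3, 2), (325, 4, 2), (326, 4, 2), (279, 8, 2),
    (329, 5, 2), (79, 9, 5), (210, 5, 2), (90, 9, 10), (328, 5, 2), (136, 9, 9), (265, 6, 3),
    (307, 3, 0), (322, 4, 2), (267, 5, 2), (307, 5, 0)]"

definition sl2_coset_tree :: "(int \<times> letter) list" where
  "sl2_coset_tree =
    [(1, S), (1, R'), (1, J), (1, R), (2, R'), (2, J), (2, R), (3, S), (3, J), (4, R'), (4, S),
    (5, S), (6, S), (6, J), (7, S), (7, R'), (8, S), (9, R), (9, J), (10, S), (11, S), (12, R'),
    (12, R), (13, J), (13, R'), (14, J), (15, S), (16, R), (16, R'), (17, S), (18, J), (19, J),
    (20, S), (21, R'), (21, R), (22, J), (22, R), (22, R'), (25, R), (27, S), (28, R), (28, R'),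
    (29, S), (31, J), (31, R), (33, S), (34, R'), (34, R), (37, R'), (37, R), (40, S), (41, R'),
    (41, R), (44, J), (45, R'), (47, R'), (47, R), (50, S), (52, R')]"

definition sl2_coset_steps :: "(int \<times> nat \<times> nat) list" where
  "sl2_coset_steps =
    [(1, 3, 1), (2, 3, 1), (12, 3, 1), (16, 3, 1), (21, 3, 1), (22, 3, 1), (28, 3, 1), (34, 3,
    1), (37, 3, 1), (41, 3, 1), (47, 3, 1), (1, 4, 1), (4, 3, 1), (2, 4, 1), (7, 3, 1), (3, 4,
    2), (6, 4, 2), (13, 4, 2), (19, 4, 1), (22, 4, 2), (37, 4, 2), (45, 4, 2), (1, 6, 3), (9, 3,
    1), (9, 4, 1), (20, 3, 1), (2, 6, 3), (13, 3, 1), (14, 4, 1), (25, 3, 1), (3, 6, 2), (4, 6,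
    2), (7, 6, 3), (31, 3, 1), (31, 4, 1), (45, 3, 1), (10, 6, 2), (11, 6, 2), (15, 6, 2), (17,
    6, 2), (20, 6, 2), (27, 6, 2), (1, 7, 2), (12, 4, 2), (16, 4, 2), (3, 7, 2), (21, 4, 2), (34,
    4, 2), (5, 7, 3), (25, 6, 2), (37, 6, 3), (52, 3, 1), (6, 7, 2), (28, 4, 2), (41, 4, 2), (8,
    7, 3), (32, 6, 2), (33, 6, 2), (19, 7, 2), (47, 4, 2), (52, 4, 2)]"

declare [[coercion_enabled = true]]

section \<open>The three descents\<close>

lemma m22_trivial_action:
  assumes "\<forall>p. word_act w p = p"
  shows "\<exists>k. set k \<subseteq> {S, J, T, R, R'} \<and> w \<approx> k"
proof -
  have complete: "complete_table [S, J, T, R, R', U] 22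
      (coset_table [S, J, T, R, R'] m22_coset_tree m22_coset_steps)"
    by code_simp
  \<comment> \<open>The subgroup fixes the new point, and each of the representatives 2 to 22 moves
    it.\<close>
  have separated: "separated [S, J, T, R, R'] [[New]] 22 (coset_reps m22_coset_tree)"
    by code_simp
  have "x \<in> set [S, J, T, R, R', U]" for x by (cases x) simp_all
  then show ?thesis
    using trivial_action_descends[OF _ complete _ separated _ assms] by auto
qed

text \<open>The subgroup \<open>SL\<^sub>2(4) = \<langle>s, j, r\<rangle>\<close> stabilises the point \<open>[0, 0, 1]\<close> and the line \<open>z = 0\<close>.\<close>

lemma psl_trivial_action:
  assumes "set w \<subseteq> {S, J, T, R, R'}" "\<forall>p. word_act w p = p"
  shows "\<exists>k. set k \<subseteq> {S, J, R, R'} \<and> w \<approx> k"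
proof -
  have complete: "complete_table [S, J, T, R, R'] 336
      (coset_table [S, J, R, R'] psl_coset_tree psl_coset_steps)"
    by code_simp
  \<comment> \<open>\<open>Vert\<close> is [0, 0, 1], and the second list is the line z = 0. There
    are 21 * 16 = 336 pairs of a point and a line not through it.\<close>
  have separated: "separated [S, J, R, R']
      [[Vert], [Inf F0, Aff F0 F0, Aff F1 F0, Aff Fz F0, Aff Fz' F0]] 336 (coset_reps psl_coset_tree)"
    by code_simp
  show ?thesis
    using trivial_action_descends[OF _ complete _ separated _ assms(2)] assms(1) by auto
qed

text \<open>Enumeration over the trivial subgroup lists the elements themselves, at most 60 =
  |SL(2,4)| of them; all but the first move some point.\<close>

lemma sl2_trivial_action:
  assumes "set w \<subseteq> {S, J, R, R'}" "\<forall>p. word_act w p = p"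
  shows "w \<approx> []"
proof -
  have complete: "complete_table [S, J, R, R'] 60 (coset_table [] sl2_coset_tree sl2_coset_steps)"
    by code_simp
  have separated: "separated [] (map (\<lambda>p. [p]) pnts) 60 (coset_reps sl2_coset_tree)"
    by code_simp
  show ?thesis
    using trivial_action_descends[OF _ complete _ separated _ assms(2)] assms(1) by auto
qed

lemma trivial_action:
  assumes "word_act w = id"
  shows "w \<approx> []"
proof -
  have w: "\<forall>p. word_act w p = p" using assms by simp
  obtain k where k: "set k \<subseteq> {S, J, T, R, R'}" "w \<approx> k"
    using m22_trivial_action[OF w] by blast
  with w have "\<forall>p. word_act k p = p" by (simp add: word_act_equ)
  with k(1) obtain k' where k': "set k' \<subseteq> {S, J, R, R'}" "k \<approx> k'"
    using psl_trivial_action by blast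
  with k(2) have "w \<approx> k'" using equ_trans by blast
  moreover from this w have "\<forall>p. word_act k' p = p" by (simp add: word_act_equ)
  with k'(1) have "k' \<approx> []" by (rule sl2_trivial_action)
  ultimately show ?thesis by (rule equ_trans)
qed

section \<open>The action on the projective plane\<close>

locale field4 =
  fixes \<zeta> :: "'k::field"
  assumes card: "CARD('k) = 4" and primitive: "primitive_element \<zeta>"
begin

section \<open>Arithmetic in the field of four elements\<close>

lemma minus_one: "(-1::'k) = 1"
proof -
  have "inj (\<lambda>c::'k. c\<^sup>2)"
    using field_card4_bij_square[OF card] by (rule bij_is_inj)
  then show ?thesis by (rule injD) simp
qed

lemma minus_eq [simp]: "- a = (a::'k)"
proof -
  have "- a = - 1 * a" by simp
  then show ?thesis by (simp only: minus_one mult_1)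
qed

lemma add_self [simp]: "a + a = (0::'k)" "a + (a + b) = (b::'k)"
  using add.right_inverse[of a] by (simp_all only: minus_eq add_0 flip: add.assoc)

lemma two_eq_0 [simp]: "2 = (0::'k)"
  by (simp only: add_self flip: one_add_one)

text \<open>The powers of \<zeta> fill the three nonzero elements; if the square of \<zeta> were 1,
  there would be at most two powers.\<close>

lemma zeta_neq: "\<zeta> \<noteq> 0" "\<zeta> \<noteq> 1" "\<zeta>\<^sup>2 \<noteq> 1"
  and field_eq: "(UNIV::'k set) = {0, 1, \<zeta>, \<zeta>\<^sup>2}"
proof -
  have range: "range (\<lambda>n::nat. \<zeta> ^ n) = - {0}"
    using primitive by (simp add: primitive_element_def)
  have fin: "finite (UNIV::'k set)"
    using card card.infinite by fastforce
  have "card (- {0} :: 'k set) = 3"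
    using card fin by (simp add: Compl_eq_Diff_UNIV)
  then have card3: "\<not> - {0} \<subseteq> {1, \<zeta>}"
    using card_mono[of "{1, \<zeta>}" "- {0}"] card_insert_le_m1[of 2 "{\<zeta>}" 1] by auto
  show z0: "\<zeta> \<noteq> 0"
    using range rangeI[of "\<lambda>n::nat. \<zeta> ^ n" 1] by auto
  show z2: "\<zeta>\<^sup>2 \<noteq> 1"
  proof
    assume *: "\<zeta>\<^sup>2 = 1"
    have power: "\<zeta> ^ n \<in> {1, \<zeta>}" for n
      by (induction n) (use * in \<open>auto simp: power2_eq_square\<close>)
    have "range (\<lambda>n::nat. \<zeta> ^ n) \<subseteq> {1, \<zeta>}" by (intro image_subsetI power)
    with range card3 show False by metis
  qed
  then show z1: "\<zeta> \<noteq> 1" by auto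
  have "\<zeta>\<^sup>2 \<noteq> \<zeta>" "\<zeta>\<^sup>2 \<noteq> 0"
    using z0 z1 by (auto simp: power2_eq_square)
  with z0 z1 z2 have "card {0, 1, \<zeta>, \<zeta>\<^sup>2} = 4" by auto
  then show "(UNIV::'k set) = {0, 1, \<zeta>, \<zeta>\<^sup>2}"
    using card_subset_eq[OF fin subset_UNIV] card by metis
qed

text \<open>\<zeta> + 1 differs from 0, 1 and \<zeta>, so it is the one remaining element.\<close>

lemma zeta_square: "\<zeta> * \<zeta> = \<zeta> + 1"
proof -
  have "\<zeta> + 1 \<noteq> 0" using zeta_neq(2) by (metis add_self(2) add.right_neutral)
  moreover have "\<zeta> + 1 \<noteq> 1" "\<zeta> + 1 \<noteq> \<zeta>" using zeta_neq(1) by simp_all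
  ultimately have "\<zeta> + 1 = \<zeta>\<^sup>2" using field_eq by blast
  then show ?thesis by (simp add: power2_eq_square)
qed

lemma inverse_zeta: "inverse \<zeta> = \<zeta> + 1"
  by (rule inverse_unique) (simp add: distrib_left zeta_square)

lemma field_cases: "a = 0 \<or> a = 1 \<or> a = \<zeta> \<or> a = \<zeta> + 1"
  using field_eq zeta_square by (auto simp: power2_eq_square set_eq_iff)

section \<open>Embedding of the computable model of the field\<close>

fun emb :: "gf4 \<Rightarrow> 'k" where
  "emb F0 = 0"
| "emb F1 = 1"
| "emb Fz = \<zeta>"
| "emb Fz' = \<zeta> + 1"

lemma emb_gadd [simp]: "emb (gadd a b) = emb a + emb b"
  by (cases a; cases b) (simp_all add: ac_simps)

lemma emb_gmul [simp]: "emb (gmul a b) = emb a * emb b"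
  by (cases a; cases b) (simp_all add: distrib_left distrib_right zeta_square ac_simps)

lemma inj_emb: "emb a = emb b \<longleftrightarrow> a = b"
proof -
  have "1 \<noteq> \<zeta>" "\<zeta> + 1 \<noteq> 0" "\<zeta> \<noteq> 0"
    using zeta_neq by (auto simp: add_eq_0_iff)
  then show ?thesis
    by (cases a; cases b) auto
qed

lemma emb_eq_0 [simp]: "emb a = 0 \<longleftrightarrow> a = F0"
  using inj_emb[of a F0] by simp

lemma surj_emb: "\<exists>a. emb a = c"
  using field_cases[of c] by (metis emb.simps)

lemma emb_ginv: "a \<noteq> F0 \<Longrightarrow> emb a * emb (ginv a) = 1"
  by (cases a) (simp_all add: distrib_left distrib_right zeta_square ac_simps)

fun vec3 :: "gf4 \<times> gf4 \<times> gf4 \<Rightarrow> 'k ^ 3" where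
  "vec3 (x, y, z) = vector [emb x, emb y, emb z]"

lemma vec3_eq_0: "vec3 t = 0 \<longleftrightarrow> t = (F0, F0, F0)"
  by (cases t) (simp add: vec_eq_iff forall_3)

lemma surj_vec3: "\<exists>t. vec3 t = v"
proof -
  obtain x y z where "emb x = v $ 1" "emb y = v $ 2" "emb z = v $ 3"
    using surj_emb by metis
  then have "vec3 (x, y, z) = v" by (simp add: vec_eq_iff forall_3)
  then show ?thesis ..
qed

section \<open>Points of the extended plane and their codes\<close>

definition point :: "pnt \<Rightarrow> 'k point option" where
  "point p = (if p = New then None else Some (proj_point (vec3 (coords p))))"

lemma proj_point_scale: "c \<noteq> 0 \<Longrightarrow> proj_point (c *s v) = proj_point (v :: 'k ^ 3)"
  unfolding proj_point_def vec.span_singleton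
proof (intro equalityI subsetI)
  fix w assume "c \<noteq> 0" "w \<in> range (\<lambda>k. k *s v)"
  then obtain k where "w = k *s v" by blast
  then have "w = (k / c) *s (c *s v)" using \<open>c \<noteq> 0\<close> by (simp add: vector_smult_assoc)
  then show "w \<in> range (\<lambda>k. k *s (c *s v))" by blast
qed (auto simp: vector_smult_assoc)

lemma normal_form_eq_New: "normal_form t = New \<longleftrightarrow> t = (F0, F0, F0)"
  by (cases t) auto

lemma point_normal_form:
  assumes "t \<noteq> (F0, F0, F0)"
  shows "point (normal_form t) = Some (proj_point (vec3 t))"
proof -
  obtain x y z where t: "t = (x, y, z)" by (cases t)
  have cancel: "emb a * (emb (ginv a) * b) = b" if "a \<noteq> F0" for a b
    using emb_ginv[OF that] by (metis mult.assoc mult_1)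
  \<comment> \<open>The leading coordinate, by which \<open>normal_form\<close> divides.\<close>
  define c where "c = (if x \<noteq> F0 then x else if y \<noteq> F0 then y else z)"
  have "emb c \<noteq> 0" using assms by (auto simp: c_def t)
  moreover have "vec3 t = emb c *s vec3 (coords (normal_form t))"
    using assms by (auto simp: t c_def vec_eq_iff forall_3 cancel)
  ultimately have "proj_point (vec3 t) = proj_point (vec3 (coords (normal_form t)))"
    by (metis proj_point_scale)
  then show ?thesis
    using assms by (simp add: point_def normal_form_eq_New)
qed

lemma coords_eq_0: "coords p = (F0, F0, F0) \<longleftrightarrow> p = New"
  by (cases p) auto

text \<open>Points spanning the same line have proportional coordinates; the first nonzero
  coordinate of each is 1, so the factor is 1.\<close>

lemma inj_point: "inj point"
proof (rule injI)
  fix p q assume eq: "point p = point q"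
  show "p = q"
  proof (cases "p = New \<or> q = New")
    case True
    with eq show ?thesis by (auto simp: point_def split: if_splits)
  next
    case False
    with eq have "vec3 (coords p) \<in> proj_point (vec3 (coords q))"
      unfolding point_def proj_point_def by (auto intro: vec.span_base)
    then obtain c where "vec3 (coords p) = c *s vec3 (coords q)"
      by (auto simp: proj_point_def vec.span_singleton)
    with False show ?thesis
      by (cases p; cases q) (auto simp: vec_eq_iff forall_3 inj_emb)
  qed
qed

lemma range_point: "range point = ext_plane"
proof (intro equalityI subsetI)
  fix q assume "q \<in> range point"
  then show "q \<in> ext_plane"
    by (auto simp: point_def ext_plane_def proj_plane_def vec3_eq_0 coords_eq_0)
next
  fix q :: "'k point option" assume "q \<in> ext_plane"
  then consider "q = None" | v where "v \<noteq> 0" "q = Some (proj_point v)"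
    by (auto simp: ext_plane_def proj_plane_def)
  then show "q \<in> range point"
  proof cases
    case 1
    then show ?thesis using rangeI[of point New] by (simp add: point_def)
  next
    case 2
    obtain t where "vec3 t = v" using surj_vec3 by blast
    with 2 have "q = point (normal_form t)"
      using point_normal_form vec3_eq_0 by metis
    then show ?thesis by blast
  qed
qed

lemma point_in_ext_plane [simp]: "point p \<in> ext_plane"
  using range_point by blast

lemma point_New [simp]: "point New = None"
  by (simp add: point_def)

section \<open>Words as permutations of the extended plane\<close>

definition perm :: "letter list \<Rightarrow> 'k point option \<Rightarrow> 'k point option" where
  "perm w = (\<lambda>q\<in>ext_plane. point (word_act w (inv_into UNIV point q)))"

lemma perm_point: "perm w (point p) = point (word_act w p)"
  by (simp add: perm_def inv_f_f[OF inj_point])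

lemma perm_eqI:
  assumes "f \<in> extensional ext_plane" "\<And>p. f (point p) = point (word_act w p)"
  shows "f = perm w"
proof (rule extensionalityI[OF assms(1)])
  show "perm w \<in> extensional ext_plane" by (simp add: perm_def)
  fix q :: "'k point option" assume "q \<in> ext_plane"
  then obtain p where "q = point p" using range_point by blast
  then show "f q = perm w q" by (simp add: assms(2) perm_point)
qed

lemma perm_append: "perm (v @ w) = compose ext_plane (perm v) (perm w)"
  by (rule perm_eqI[symmetric]) (simp_all add: compose_def perm_point)

lemma perm_Nil: "perm [] = (\<lambda>q\<in>ext_plane. q)"
  by (rule perm_eqI[symmetric]) simp_all

lemma perm_cong: "v \<approx> w \<Longrightarrow> perm v = perm w"
  by (simp add: perm_def word_act_equ)

lemma perm_eq_iff: "perm v = perm w \<longleftrightarrow> word_act v = word_act w"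
proof
  assume "perm v = perm w"
  then have "point (word_act v p) = point (word_act w p)" for p by (metis perm_point)
  then show "word_act v = word_act w"
    using inj_point by (auto simp: fun_eq_iff dest: injD)
qed (simp add: perm_def)

lemma compose_perm_winv: "compose ext_plane (perm w) (perm (winv w)) = perm []"
  using perm_cong[OF equ_winv] by (simp add: perm_append)

lemma perm_in_Bij: "perm w \<in> Bij ext_plane"
proof -
  have inverse: "perm v (perm (winv v) q) = q" if "q \<in> ext_plane" for v q
    using fun_cong[OF compose_perm_winv, of v q] that by (simp add: compose_def perm_Nil)
  have "perm v \<in> ext_plane \<rightarrow> ext_plane" for v
    by (simp add: perm_def)
  then have "bij_betw (perm w) ext_plane ext_plane"
    using inverse[of _ w] inverse[of _ "winv w"]
    by (intro bij_betwI[of _ _ _ "perm (winv w)"]) auto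
  then show ?thesis by (simp add: Bij_def perm_def)
qed

section \<open>The given generators as permutations\<close>

lemma mat_perm_point:
  assumes "p \<noteq> New" "A *v vec3 (coords p) = vec3 t" "t \<noteq> (F0, F0, F0)"
  shows "mat_perm A (point p) = point (normal_form t)"
proof -
  have "(\<lambda>v. A *v v) ` proj_point v = proj_point (A *v v)" for v
    by (simp add: proj_point_def vec.span_singleton image_image matrix_vector_mult_scaleR
        vector_scalar_commute)
  then show ?thesis
    using assms point_in_ext_plane[of p] by (simp add: mat_perm_def point_normal_form)
      (simp add: point_def)
qed

text \<open>In the nonlinear case \<open>U\<close>, vanishing of the last two coordinates gives y =
  z = 0, and the first one is then the square of x.\<close>

lemma transform_neq_0: "t \<noteq> (F0, F0, F0) \<Longrightarrow> transform x t \<noteq> (F0, F0, F0)"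
proof -
  assume t: "t \<noteq> (F0, F0, F0)"
  have [simp]: "gmul a b = F0 \<longleftrightarrow> a = F0 \<or> b = F0" "gadd a F0 = a" for a b
    by (cases a; cases b; simp)+
  show ?thesis using t by (cases x; cases t) auto
qed

lemma mat_perm_eq_perm:
  assumes "x \<noteq> U" "\<And>t. A *v vec3 t = vec3 (transform x t)"
  shows "mat_perm A = perm [x]"
proof (rule perm_eqI)
  show "mat_perm A \<in> extensional ext_plane" by (simp add: mat_perm_def)
  fix p
  have New: "transform x (F0, F0, F0) = (F0, F0, F0)" using assms(1) by (cases x) simp_all
  show "mat_perm A (point p) = point (word_act [x] p)"
  proof (cases "p = New")
    case True
    then have "word_act [x] p = New" using assms(1) New by (simp add: act_def)
    with True show ?thesis by (simp add: mat_perm_def point_def ext_plane_def)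
  next
    case False
    then have "transform x (coords p) \<noteq> (F0, F0, F0)"
      by (simp add: transform_neq_0 coords_eq_0)
    with False assms show ?thesis by (simp add: mat_perm_point act_def)
  qed
qed

text \<open>The matrices are compared with \<open>transform\<close> entry by entry, where \<zeta> +
  1, the code of \<open>Fz'\<close>, is the inverse of \<zeta>. For \<open>u\<close>, the new point
  and [1, 0, 0] are separate cases.\<close>

lemma gen_perm_eq_perm: "gen_perm \<zeta> x = perm [letter_of (x, True)]"
proof (cases x)
  case Gu
  have e: "Some (proj_point (vector [1, 0, 0])) = point (Aff F0 F0)"
    by (simp add: point_def)
  have "u_perm (point p) = point (act U p)" for p
  proof (cases "p = New")
    case True
    then show ?thesis
      using e by (simp add: u_perm_def ext_plane_def point_def act_def)
  next
    case False
    then have p: "point p = Some (proj_point (vec3 (coords p)))" by (simp add: point_def)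
    show ?thesis
    proof (cases "p = Aff F0 F0")
      case True
      then show ?thesis
        using point_in_ext_plane[of p] by (simp add: u_perm_def act_def flip: e)
    next
      case neq: False
      then have "proj_point (vec3 (coords p)) \<noteq> proj_point (vector [1, 0, 0])"
        using e p inj_point by (metis injD)
      moreover have "u_map (vec3 t) = vec3 (transform U t)" for t
        by (cases t) (simp add: u_map_def power2_eq_square)
      moreover have "transform U (coords p) \<noteq> (F0, F0, F0)"
        using False by (simp add: transform_neq_0 coords_eq_0)
      ultimately have "u_perm (point p) = point (normal_form (transform U (coords p)))"
        using point_in_ext_plane[of p] p
        by (simp add: u_perm_def u_map_proj_point[OF card] point_normal_form del: transform.simps)
      with False neq show ?thesis by (simp add: act_def)
    qed
  qed
  then show ?thesis
    using Gu by (intro perm_eqI) (simp_all add: u_perm_def)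
qed (auto intro!: mat_perm_eq_perm
      simp: vec_eq_iff forall_3 matrix_vector_mult_def sum_3 inverse_zeta)

end

section \<open>Generation by transvections\<close>

context field4
begin

text \<open>The determinant is carried along so that products remain compatible with composition,
  which \<open>mat_perm_mult\<close> grants for an invertible right factor.\<close>

definition word_matrix :: "'k ^ 3 ^ 3 \<Rightarrow> bool" where
  "word_matrix A \<longleftrightarrow> det A = 1 \<and> (\<exists>w. mat_perm A = perm w)"

text \<open>An invertible \<open>B\<close> sends points to points, so its values stay in
  \<open>ext_plane\<close>, the domain to which the outer map is restricted.\<close>

lemma mat_perm_mult:
  assumes "det B \<noteq> 0"
  shows "mat_perm (A ** B) = compose ext_plane (mat_perm A) (mat_perm (B :: 'k ^ 3 ^ 3))"
proof
  fix q
  have image: "(\<lambda>v. B *v v) ` proj_point v = proj_point (B *v v)" for v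
    by (simp add: proj_point_def vec.span_singleton image_image vector_scalar_commute)
  have "B *v v \<noteq> 0" if "v \<noteq> 0" for v
    using that assms by (metis invertible_det_nz invertible_left_inverse matrix_left_invertible_ker)
  then have "mat_perm B q \<in> ext_plane" if "q \<in> ext_plane"
    using that by (auto simp: mat_perm_def ext_plane_def proj_plane_def image)
  then show "mat_perm (A ** B) q = compose ext_plane (mat_perm A) (mat_perm B) q"
    by (auto simp: compose_def mat_perm_def option.map_comp o_def image_image
        matrix_vector_mul_assoc intro!: option.map_cong)
qed

lemma word_matrix_mult:
  assumes "word_matrix A" "word_matrix B"
  shows "word_matrix (A ** B)"
  using assms unfolding word_matrix_def
  by (metis det_mul mat_perm_mult mult_1 perm_append zero_neq_one)

abbreviation matrix3 :: "'k \<Rightarrow> 'k \<Rightarrow> 'k \<Rightarrow> 'k \<Rightarrow> 'k \<Rightarrow> 'k \<Rightarrow> 'k \<Rightarrow> 'k \<Rightarrow> 'k \<Rightarrow> 'k ^ 3 ^ 3" where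
  "matrix3 a b c d e f g h i \<equiv> vector [vector [a, b, c], vector [d, e, f], vector [g, h, i]]"

lemma matrix3_mult:
  "matrix3 a b c d e f g h i ** matrix3 a' b' c' d' e' f' g' h' i' =
    matrix3 (a * a' + b * d' + c * g') (a * b' + b * e' + c * h') (a * c' + b * f' + c * i')
      (d * a' + e * d' + f * g') (d * b' + e * e' + f * h') (d * c' + e * f' + f * i')
      (g * a' + h * d' + i * g') (g * b' + h * e' + i * h') (g * c' + h * f' + i * i')"
  by (simp add: vec_eq_iff forall_3 matrix_matrix_mult_def sum_3)

lemma matrix3_exhaust: "\<exists>a b c d e f g h i. A = matrix3 a b c d e f g h i"
proof -
  have "A = matrix3 (A $ 1 $ 1) (A $ 1 $ 2) (A $ 1 $ 3) (A $ 2 $ 1) (A $ 2 $ 2) (A $ 2 $ 3)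
      (A $ 3 $ 1) (A $ 3 $ 2) (A $ 3 $ 3)"
    by (simp add: vec_eq_iff forall_3)
  then show ?thesis by blast
qed

text \<open>In characteristic 2 all signs of the Leibniz formula become plus.\<close>

lemma det_matrix3:
  "det (matrix3 a b c d e f g h i) =
    a * e * i + b * f * g + c * d * h + a * f * h + b * d * i + c * e * g"
  by (simp add: det_3 diff_conv_add_uminus del: add_uminus_conv_diff)

lemma word_matrix_generators:
  "word_matrix (matrix3 1 1 0 0 1 0 0 0 1)"
  "word_matrix (matrix3 0 1 0 1 0 0 0 0 1)"
  "word_matrix (matrix3 0 0 1 0 1 0 1 0 0)"
  "word_matrix (matrix3 \<zeta> 0 0 0 1 0 0 0 (\<zeta> + 1))"
  using gen_perm_eq_perm[of Gs] gen_perm_eq_perm[of Gj] gen_perm_eq_perm[of Gt]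
    gen_perm_eq_perm[of Gr]
  by (auto simp: word_matrix_def det_matrix3 inverse_zeta distrib_left zeta_square)

lemma word_matrix_one: "word_matrix (matrix3 1 0 0 0 1 0 0 0 1)"
  using word_matrix_mult[OF word_matrix_generators(1) word_matrix_generators(1)]
  by (simp add: matrix3_mult)

text \<open>Conjugating \<open>s\<close> by \<open>r\<close> and by its inverse turns the
  off-diagonal 1 into \<zeta> and \<zeta> + 1. Conjugation by the permutation matrices
  \<open>j\<close> and \<open>t\<close> then carries position (1, 2) to all others.\<close>

lemma word_matrix_transvections:
  "word_matrix (matrix3 1 c 0 0 1 0 0 0 1)" (is ?E12)
  "word_matrix (matrix3 1 0 0 c 1 0 0 0 1)" (is ?E21)
  "word_matrix (matrix3 1 0 0 0 1 0 0 c 1)" (is ?E32)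
  "word_matrix (matrix3 1 0 0 0 1 c 0 0 1)" (is ?E23)
  "word_matrix (matrix3 1 0 0 0 1 0 c 0 1)" (is ?E31)
  "word_matrix (matrix3 1 0 c 0 1 0 0 0 1)" (is ?E13)
proof -
  note S = word_matrix_generators(1) and J = word_matrix_generators(2)
    and T = word_matrix_generators(3) and R = word_matrix_generators(4)
  note simps = matrix3_mult distrib_left distrib_right zeta_square ac_simps
  have R': "word_matrix (matrix3 (\<zeta> + 1) 0 0 0 1 0 0 0 \<zeta>)"
    using word_matrix_mult[OF R R] by (simp add: simps)
  have Ez: "word_matrix (matrix3 1 \<zeta> 0 0 1 0 0 0 1)"
    using word_matrix_mult[OF R word_matrix_mult[OF S R']] by (simp add: simps)
  have Ez': "word_matrix (matrix3 1 (\<zeta> + 1) 0 0 1 0 0 0 1)"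
    using word_matrix_mult[OF R' word_matrix_mult[OF S R]] by (simp add: simps)
  from field_cases[of c] show E12: ?E12
    using S Ez Ez' word_matrix_one by auto
  show E21: ?E21
    using word_matrix_mult[OF J word_matrix_mult[OF E12 J]] by (simp add: matrix3_mult)
  show E32: ?E32
    using word_matrix_mult[OF T word_matrix_mult[OF E12 T]] by (simp add: matrix3_mult)
  show E23: ?E23
    using word_matrix_mult[OF T word_matrix_mult[OF E21 T]] by (simp add: matrix3_mult)
  show ?E31
    using word_matrix_mult[OF J word_matrix_mult[OF E32 J]] by (simp add: matrix3_mult)
  show ?E13
    using word_matrix_mult[OF J word_matrix_mult[OF E23 J]] by (simp add: matrix3_mult)
qed

section \<open>Reduction of matrices of determinant 1\<close>

text \<open>Transvections are involutions in characteristic 2, so they can be cancelled from either side.\<close>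

lemma word_matrix_row_ops:
  "word_matrix (matrix3 (a + t * d) (b + t * e) (c + t * f) d e f g h i) \<Longrightarrow>
    word_matrix (matrix3 a b c d e f g h i)"
  "word_matrix (matrix3 a b c (d + t * a) (e + t * b) (f + t * c) g h i) \<Longrightarrow>
    word_matrix (matrix3 a b c d e f g h i)"
  "word_matrix (matrix3 a b c d e f (g + t * a) (h + t * b) (i + t * c)) \<Longrightarrow>
    word_matrix (matrix3 a b c d e f g h i)"
  "word_matrix (matrix3 a b c (d + t * g) (e + t * h) (f + t * i) g h i) \<Longrightarrow>
    word_matrix (matrix3 a b c d e f g h i)"
  "word_matrix (matrix3 a b c d e f (g + t * d) (h + t * e) (i + t * f)) \<Longrightarrow>
    word_matrix (matrix3 a b c d e f g h i)"
  using word_matrix_mult[OF word_matrix_transvections(1)[of t]]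
    word_matrix_mult[OF word_matrix_transvections(2)[of t]]
    word_matrix_mult[OF word_matrix_transvections(5)[of t]]
    word_matrix_mult[OF word_matrix_transvections(4)[of t]]
    word_matrix_mult[OF word_matrix_transvections(3)[of t]]
  by (force simp: matrix3_mult ac_simps)+

lemma word_matrix_column_ops:
  "word_matrix (matrix3 a (b + t * a) c d (e + t * d) f g (h + t * g) i) \<Longrightarrow>
    word_matrix (matrix3 a b c d e f g h i)"
  "word_matrix (matrix3 a b (c + t * a) d e (f + t * d) g h (i + t * g)) \<Longrightarrow>
    word_matrix (matrix3 a b c d e f g h i)"
  using word_matrix_mult[OF _ word_matrix_transvections(1)[of t]]
    word_matrix_mult[OF _ word_matrix_transvections(6)[of t]]
  by (force simp: matrix3_mult ac_simps)+

lemma word_matrix_block: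
  assumes "e * i + f * h = 1"
  shows "word_matrix (matrix3 1 0 0 0 e f 0 h i)"
proof -
  have nonzero: "word_matrix (matrix3 1 0 0 0 e f 0 h i)" if "h \<noteq> 0" "e * i + f * h = 1" for e f h i
  proof -
    \<comment> \<open>Adding \<open>t\<close> times row 3 to row 2 turns \<open>e\<close> into 1.
      Clearing \<open>h\<close> with the new row 2 then leaves a transvection, as the determinant
      forces the last entry to be 1.\<close>
    define t where "t = (e + 1) / h"
    have th: "t * h = e + 1" using that(1) by (simp add: t_def)
    define f' where "f' = f + t * i"
    have "i + h * f' = i + (f * h + (t * h) * i)"
      by (simp add: f'_def algebra_simps)
    also have "\<dots> = i + (f * h + (e + 1) * i)"
      by (simp only: th)
    also have "\<dots> = 1"
      using that(2) by (simp add: algebra_simps)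
    finally have "word_matrix (matrix3 1 0 0 0 1 f' 0 h i)"
      using word_matrix_transvections(4)[of f']
      by - (rule word_matrix_row_ops(5)[where t = h], simp)
    then show ?thesis
      by - (rule word_matrix_row_ops(4)[where t = t], simp add: th f'_def)
  qed
  show ?thesis
  proof (cases "h = 0")
    case True
    with assms have "e * i = 1" by simp
    then have "e \<noteq> 0" by auto
    \<comment> \<open>Adding row 2 to row 3 puts the nonzero \<open>e\<close> in the place of
      \<open>h\<close>.\<close>
    with \<open>e * i = 1\<close> have "word_matrix (matrix3 1 0 0 0 e f 0 e (i + f))"
      by (intro nonzero) (simp_all add: algebra_simps)
    with True show ?thesis
      by - (rule word_matrix_row_ops(5)[where t = 1], simp)
  qed (use nonzero assms in simp)
qed

text \<open>The entry 1 clears its column by row operations and its row by column operations. What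
  remains is its Schur complement, a block of determinant 1.\<close>

lemma word_matrix_unit_entry:
  assumes "det (matrix3 1 b c d e f g h i) = 1"
  shows "word_matrix (matrix3 1 b c d e f g h i)"
proof -
  define e' f' h' i' where "e' = e + d * b" and "f' = f + d * c" and "h' = h + g * b"
    and "i' = i + g * c"
  have "e' * i' + f' * h' = 1"
    using assms unfolding e'_def f'_def h'_def i'_def det_matrix3
    by (simp add: algebra_simps)
  then have "word_matrix (matrix3 1 0 0 0 e' f' 0 h' i')"
    by (rule word_matrix_block)
  then have "word_matrix (matrix3 1 b c 0 e' f' 0 h' i')"
    by - (rule word_matrix_column_ops(1)[where t = b],
        rule word_matrix_column_ops(2)[where t = c], simp)
  then show ?thesis
    unfolding e'_def f'_def h'_def i'_def
    by - (rule word_matrix_row_ops(2)[where t = d], rule word_matrix_row_ops(3)[where t = g], simp)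
qed

text \<open>A nonzero \<open>d\<close> allows the upper left entry to be made 1. If
  \<open>d = 0\<close>, a row with nonzero first entry is first added to row 2; it exists because
  the determinant is not 0.\<close>

lemma word_matrix_det_1:
  assumes "det A = 1"
  shows "word_matrix A"
proof -
  have nonzero: "word_matrix (matrix3 a b c d e f g h i)"
    if "d \<noteq> 0" "det (matrix3 a b c d e f g h i) = 1" for a b c d e f g h i
  proof -
    define t where "t = (a + 1) / d"
    have *: "a + t * d = 1" using that(1) by (simp add: t_def)
    have "det (matrix3 (a + t * d) (b + t * e) (c + t * f) d e f g h i) = 1"
      using that(2) unfolding det_matrix3 by (simp add: algebra_simps)
    then show ?thesis
      by - (rule word_matrix_row_ops(1)[where t = t], simp add: * word_matrix_unit_entry)
  qed
  obtain a b c d e f g h i where A: "A = matrix3 a b c d e f g h i"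
    using matrix3_exhaust by blast
  consider "d \<noteq> 0" | "d = 0" "g \<noteq> 0" | "d = 0" "g = 0" by blast
  then show ?thesis
  proof cases
    case 1
    with assms show ?thesis by (simp add: A nonzero)
  next
    case 2
    then show ?thesis
      using assms unfolding A det_matrix3
      by - (rule word_matrix_row_ops(4)[where t = 1], intro nonzero; simp add: det_matrix3 algebra_simps)
  next
    case 3
    then have "a \<noteq> 0" using assms unfolding A det_matrix3 by auto
    with 3 show ?thesis
      using assms unfolding A det_matrix3
      by - (rule word_matrix_row_ops(2)[where t = 1], intro nonzero; simp add: det_matrix3 algebra_simps)
  qed
qed

section \<open>The elements of the permutation group are those given by words\<close>

lemma carrier_m22: "carrier m22 = range perm"
proof -
  let ?G = "BijGroup (ext_plane :: 'k point option set)"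
  interpret G: group ?G by (rule group_BijGroup)
  have mult: "perm v \<otimes>\<^bsub>?G\<^esub> perm w = perm (v @ w)" for v w
    by (simp add: BijGroup_def perm_in_Bij perm_append)
  have carrier: "perm w \<in> carrier ?G" for w
    by (simp add: BijGroup_def perm_in_Bij)
  have perm_one: "perm [] = \<one>\<^bsub>?G\<^esub>"
    by (simp add: BijGroup_def perm_Nil)
  have inverse: "inv\<^bsub>?G\<^esub> perm w = perm (winv w)" for w
    by (rule G.inv_equality) (simp_all add: carrier mult perm_one[symmetric] perm_cong[OF equ_winv'])
  \<comment> \<open>\<open>subgroup_generated\<close> intersects the generating set with the
    carrier.\<close>
  let ?A = "carrier ?G \<inter> insert u_perm psl3"
  have gen: "perm [letter_of (x, True)] \<in> generate ?G ?A" for x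
  proof (rule generate.incl, rule IntI)
    show "perm [letter_of (x, True)] \<in> insert u_perm psl3"
      unfolding gen_perm_eq_perm[symmetric] psl3_def
      by (cases x)
        (auto intro!: image_eqI[OF HOL.refl] simp: det_matrix3 inverse_zeta distrib_left zeta_square)
  qed (rule carrier)
  have letter: "perm [x] \<in> generate ?G ?A" for x
  proof (cases "x = R'")
    case True
    then have "perm [x] = inv\<^bsub>?G\<^esub> perm [R]" by (simp add: inverse)
    with gen[of Gr] show ?thesis by (simp add: G.generate_m_inv_closed)
  next
    case False
    then have "\<exists>g. x = letter_of (g, True)"
      by (cases x) (auto intro: exI[of _ Gs] exI[of _ Gj] exI[of _ Gt] exI[of _ Gr] exI[of _ Gu])
    with gen show ?thesis by auto
  qed
  have "perm w \<in> generate ?G ?A" for w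
  proof (induction w)
    case Nil
    show ?case by (simp add: perm_one generate.one)
  next
    case (Cons x w)
    with letter[of x] show ?case
      using generate.eng mult[of "[x]" w] by fastforce
  qed
  \<comment> \<open>Conversely, every generator is given by a word, by
    \<open>word_matrix_det_1\<close> for the matrices, and such permutations are closed under
    products and inverses.\<close>
  moreover have "q \<in> range perm" if "q \<in> generate ?G ?A" for q
    using that
  proof (induction rule: generate.induct)
    case one
    show ?case unfolding perm_one[symmetric] by (rule rangeI)
  next
    case (incl h)
    have "u_perm = perm [U]" using gen_perm_eq_perm[of Gu] by simp
    with incl word_matrix_det_1 show ?case by (auto simp: psl3_def word_matrix_def)
  next
    case (inv h)
    have "u_perm = perm [U]" using gen_perm_eq_perm[of Gu] by simp
    with inv word_matrix_det_1 have "h \<in> range perm" by (auto simp: psl3_def word_matrix_def)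
    with inverse show ?case by auto
  next
    case (eng g h)
    with mult show ?case by auto
  qed
  ultimately show ?thesis
    by (auto simp: m22_def carrier_subgroup_generated)
qed

lemma mult_m22: "perm v \<otimes>\<^bsub>m22\<^esub> perm w = perm (v @ w)"
  by (simp add: m22_def BijGroup_def perm_in_Bij perm_append)

section \<open>The isomorphism\<close>

lemma presentation_iso:
  "\<exists>\<phi> \<in> iso (presented_group m22_relations) m22.
    \<forall>x. \<phi> (word_class m22_relations (gen_word x)) = gen_perm \<zeta> x"
proof -
  \<comment> \<open>The chosen representative does not affect the value, because equivalent words
    act alike.\<close>
  define \<phi> where "\<phi> c = perm (letters_of (SOME w. w \<in> c))" for c
  have \<phi>: "\<phi> (word_class m22_relations w) = perm (letters_of w)" for w
  proof -
    have "w \<in> word_class m22_relations w"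
      by (simp add: word_class_def word_equiv.refl)
    then have "(SOME w'. w' \<in> word_class m22_relations w) \<in> word_class m22_relations w"
      by (rule someI)
    then show ?thesis
      unfolding \<phi>_def word_class_def perm_eq_iff by (metis mem_Collect_eq word_act_cong)
  qed
  have "\<phi> \<in> hom (presented_group m22_relations) m22"
    by (rule homI)
      (auto simp: carrier_presented_group carrier_m22 \<phi> mult_presented_group mult_m22)
  moreover have "bij_betw \<phi> (carrier (presented_group m22_relations)) (carrier m22)"
    unfolding bij_betw_def
  proof
    show "inj_on \<phi> (carrier (presented_group m22_relations))"
    proof (rule inj_onI, unfold carrier_presented_group, elim rangeE)
      fix a b v w assume "\<phi> a = \<phi> b"
        and ab: "a = word_class m22_relations v" "b = word_class m22_relations w"
      then have act: "word_act (letters_of v) = word_act (letters_of w)"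
        by (simp add: \<phi> perm_eq_iff)
      \<comment> \<open>Injectivity reduces to faithfulness: the quotient of two words with the same
        action acts trivially, hence is trivial.\<close>
      have "word_act (letters_of v @ winv (letters_of w)) = word_act (letters_of w @ winv (letters_of w))"
        using act by (simp add: fun_eq_iff)
      also have "\<dots> = id"
        using word_act_equ[OF equ_winv] by (simp add: fun_eq_iff)
      finally have "letters_of v @ winv (letters_of w) \<approx> []"
        by (rule trivial_action)
      from equ_solve_right[OF this] show "a = b"
        by (simp add: ab word_class_eq_iff equ_letters_of_iff)
    qed
    have "\<phi> ` carrier (presented_group m22_relations) = range (\<lambda>w. perm (letters_of w))"
      by (simp add: carrier_presented_group image_image \<phi>)
    also have "\<dots> = range perm"
      using letters_of_inverse by (metis (no_types) surj_def image_image surjI)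
    finally show "\<phi> ` carrier (presented_group m22_relations) = carrier m22"
      by (simp add: carrier_m22)
  qed
  moreover have "\<phi> (word_class m22_relations (gen_word x)) = gen_perm \<zeta> x" for x
    by (simp only: \<phi> gen_perm_eq_perm gen_word_def list.map)
  ultimately show ?thesis
    unfolding iso_def by blast
qed

end

theorem proposition7p5:
  fixes \<zeta> :: "'k::field"
  assumes "CARD('k) = 4"
    and "primitive_element \<zeta>"
  shows "\<exists>\<phi> \<in> iso (presented_group m22_relations) (m22 :: ('k point option \<Rightarrow> 'k point option) monoid).
    \<forall>x. \<phi> (word_class m22_relations (gen_word x)) = gen_perm \<zeta> x"
proof -
  interpret field4 \<zeta> using assms by unfold_locales
  show ?thesis by (rule presentation_iso)
qed

end
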